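(* Let $X$ be a nonzero complex Banach space with open unit ball $\mathbb{B}$. Let $f:\mathbb{B}\to\mathbb{C}$ be holomorphic with $f(0)=1$ and suppose $F(z)=zf(z)$ belongs to $\mathcal{S}^*(\mathbb{B})$. Then for every $z\in X\setminus\{0\}$ and $l_z\in T(z)$, $$\left|A_2^3-2A_2A_3^2-A_2A_4^2+2A_3^2A_4\right|\le 84,$$ where $$A_2=\frac{l_z(D^2F(0)(z^2))}{2!\,\|z\|^2},\quad A_3=\frac{l_z(D^3F(0)(z^3))}{3!\,\|z\|^3},\quad A_4=\frac{l_z(D^4F(0)(z^4))}{4!\,\|z\|^4}.$$ The estimate is sharp.
   Context: For $z\in X\setminus\{0\}$, $T(z)=\{l_z\in L(X,\mathbb{C}): l_z(z)=\|z\|,\ \|l_z\|=1\}$, where $L(X,\mathbb{C})$ is the space of continuous linear functionals on $X$. $D^nF(0)$ is the $n$-th Fréchet derivative at $0$ and $D^nF(0)(z^n)=D^nF(0)(z,\dots,z)$. A holomorphic mapping $F:\mathbb{B}\to X$ is normalized if $F(0)=0$ and $DF(0)=I$, and locally biholomorphic if $DF(z)$ is invertible with bounded inverse for each $z\in\mathbb{B}$. $\mathcal{S}^*(\mathbb{B})$ (starlike mappings) is the class of normalized locally biholomorphic $F$ such that $\dfrac{\|z\|}{l_z([DF(z)]^{-1}F(z))}\in\Phi(\mathbb{U})$ for all $z\in\mathbb{B}\setminus\{0\}$, $l_z\in T(z)$, where $\mathbb{U}$ is the open unit disk and $\Phi(\zeta)=\frac{1+\zeta}{1-\zeta}$ (so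 $\Phi(\mathbb{U})$ is the open right half-plane). "Sharp" means: for each such $X$ there exist an $f$ satisfying the hypotheses and a $z\in X\setminus\{0\}$, $l_z\in T(z)$ for which equality holds. *)

theory Defs
  imports "HOL-Analysis.Analysis"
begin

class complex_normed_vector = real_normed_vector +
  fixes scaleC :: "complex \<Rightarrow> 'a \<Rightarrow> 'a" (infixr "*\<^sub>C" 75)
  assumes scaleC_add_right: "c *\<^sub>C (x + y) = c *\<^sub>C x + c *\<^sub>C y"
    and scaleC_add_left: "(c + d) *\<^sub>C x = c *\<^sub>C x + d *\<^sub>C x"
    and scaleC_scaleC: "c *\<^sub>C (d *\<^sub>C x) = (c * d) *\<^sub>C x"
    and scaleC_one: "1 *\<^sub>C x = x"
    and scaleC_of_real: "complex_of_real r *\<^sub>C x = r *\<^sub>R x"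
    and norm_scaleC: "norm (c *\<^sub>C x) = cmod c * norm x"

class complex_banach = complex_normed_vector + banach

instantiation complex :: complex_banach
begin

definition scaleC_complex :: "complex \<Rightarrow> complex \<Rightarrow> complex"
  where "scaleC_complex c x = c * x"

instance
  by standard
    (simp_all add: scaleC_complex_def algebra_simps norm_mult scaleR_conv_of_real)

end

definition bounded_clinear :: "('a::complex_normed_vector \<Rightarrow> 'b::complex_normed_vector) \<Rightarrow> bool"
  where "bounded_clinear L \<longleftrightarrow> bounded_linear L \<and> (\<forall>c x. L (c *\<^sub>C x) = c *\<^sub>C L x)"

definition holomorphic_map_on ::
    "('a::complex_normed_vector \<Rightarrow> 'b::complex_normed_vector) \<Rightarrow> 'a set \<Rightarrow> bool"
  where "holomorphic_map_on f S \<longleftrightarrow>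
    (\<forall>z\<in>S. \<exists>L. bounded_clinear L \<and> (f has_derivative L) (at z))"

definition support_functionals :: "'a::complex_normed_vector \<Rightarrow> ('a \<Rightarrow> complex) set"
  where "support_functionals z =
    {l. bounded_clinear l \<and> l z = complex_of_real (norm z) \<and> onorm l = 1}"

text \<open>The Frechet derivative as a map into the bounded operators with the operator norm, so that
  it can be iterated.  The type \<open>'a \<Rightarrow>\<^sub>L 'b\<close> consists of all real-linear bounded operators; since the
  complex-linear ones form a closed subspace with the same norm, the iterated derivatives of a
  holomorphic map agree with those taken in the complex operator spaces.\<close>

definition fderiv :: "('a::real_normed_vector \<Rightarrow> 'b::real_normed_vector) \<Rightarrow> 'a \<Rightarrow> 'a \<Rightarrow>\<^sub>L 'b"
  where "fderiv F z = Blinfun (frechet_derivative F (at z))"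

lemma fderiv_eqI:
  assumes "(F has_derivative D) (at z)"
  shows "blinfun_apply (fderiv F z) = D"
  using assms frechet_derivative_at[OF assms] has_derivative_bounded_linear[OF assms]
  by (simp add: fderiv_def bounded_linear_Blinfun_apply)

definition half_plane_map :: "complex \<Rightarrow> complex"
  where "half_plane_map \<zeta> = (1 + \<zeta>) / (1 - \<zeta>)"

definition normalized_map :: "('a::complex_banach \<Rightarrow> 'a) \<Rightarrow> bool"
  where "normalized_map F \<longleftrightarrow> F 0 = 0 \<and> fderiv F 0 = id_blinfun"

definition locally_biholomorphic :: "('a::complex_banach \<Rightarrow> 'a) \<Rightarrow> bool"
  where "locally_biholomorphic F \<longleftrightarrow>
    (\<forall>z\<in>ball 0 1. bij (blinfun_apply (fderiv F z)) \<and>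
       bounded_linear (inv (blinfun_apply (fderiv F z))))"

text \<open>If the denominator below vanishes, the quotient is \<open>0\<close> in HOL, which is not in the open right
  half-plane; so membership also asserts that the quotient is defined.  Maps on the unit ball are
  total functions whose values outside the ball play no role.\<close>

definition starlike_maps :: "('a::complex_banach \<Rightarrow> 'a) set"
  where "starlike_maps =
    {F. holomorphic_map_on F (ball 0 1) \<and> normalized_map F \<and> locally_biholomorphic F \<and>
       (\<forall>z\<in>ball 0 1 - {0}. \<forall>l\<in>support_functionals z.
          complex_of_real (norm z) / l (inv (blinfun_apply (fderiv F z)) (F z))
            \<in> half_plane_map ` ball 0 1)}"

definition A2 :: "('a::complex_banach \<Rightarrow> 'a) \<Rightarrow> ('a \<Rightarrow> complex) \<Rightarrow> 'a \<Rightarrow> complex"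
  where "A2 F l z =
    l (blinfun_apply (blinfun_apply (fderiv (fderiv F) 0) z) z)
      / (fact 2 * complex_of_real (norm z ^ 2))"

definition A3 :: "('a::complex_banach \<Rightarrow> 'a) \<Rightarrow> ('a \<Rightarrow> complex) \<Rightarrow> 'a \<Rightarrow> complex"
  where "A3 F l z =
    l (blinfun_apply (blinfun_apply (blinfun_apply (fderiv (fderiv (fderiv F)) 0) z) z) z)
      / (fact 3 * complex_of_real (norm z ^ 3))"

definition A4 :: "('a::complex_banach \<Rightarrow> 'a) \<Rightarrow> ('a \<Rightarrow> complex) \<Rightarrow> 'a \<Rightarrow> complex"
  where "A4 F l z =
    l (blinfun_apply (blinfun_apply (blinfun_apply (blinfun_apply
        (fderiv (fderiv (fderiv (fderiv F))) 0) z) z) z) z)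
      / (fact 4 * complex_of_real (norm z ^ 4))"

end

theory Submission
  imports Defs "HOL-Complex_Analysis.Complex_Analysis"
begin

text \<open>
  Fix \<open>z \<noteq> 0\<close> and put \<open>u = z / \<parallel>z\<parallel>\<close>.  Along the complex line through \<open>u\<close> the map \<open>F z = f z *\<^sub>C z\<close>
  is \<open>F (\<zeta> *\<^sub>C u) = g \<zeta> *\<^sub>C u\<close> with \<open>g \<zeta> = \<zeta> * h \<zeta>\<close> and \<open>h \<zeta> = f (\<zeta> *\<^sub>C u)\<close>.  The derivative of \<open>F\<close> at
  \<open>p = \<zeta> *\<^sub>C u\<close> multiplies \<open>p\<close> by the scalar \<open>f p + Df(p) p\<close>, so it can be inverted explicitly on
  \<open>F p = f p *\<^sub>C p\<close>, and the defining quotient of a starlike map becomes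
  \<open>(h \<zeta> + \<zeta> h' \<zeta>) / h \<zeta> = \<zeta> g' \<zeta> / g \<zeta>\<close> (lemma \<open>starlike_quotient\<close>).  Hence \<open>g\<close> is a starlike
  function on the unit disc, and \<open>A2\<close>, \<open>A3\<close>, \<open>A4\<close> are its Taylor coefficients
  (lemma \<open>slice_of_scaleC_ident\<close>).

  Starlikeness of \<open>g\<close> says that \<open>h' = \<phi> (2 h + \<zeta> h')\<close> for some holomorphic \<open>\<phi>\<close> bounded by 1.  Comparing
  coefficients, with \<open>\<phi> = c0 + c1 \<zeta> + c2 \<zeta>^2 + ...\<close>,
  \<open>a2 = 2 c0\<close>, \<open>a3 = c1 + 3 c0^2\<close>, \<open>a4 = (2/3) c2 + (10/3) c0 c1 + 4 c0^3\<close>.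
  The determinant factors as \<open>(a2 - a4) (a2^2 - (2 a3^2 - a2 a4))\<close>, and \<open>\<bar>c1\<bar>\<close> and \<open>\<bar>c2\<bar>\<close> are both at
  most \<open>1 - \<bar>c0\<bar>^2\<close>; this yields \<open>\<bar>a2\<bar> \<le> 2\<close>, \<open>\<bar>a4\<bar> \<le> 4\<close> and \<open>\<bar>2 a3^2 - a2 a4\<bar> \<le> 10\<close>, hence the
  bound \<open>(2 + 4) (4 + 10) = 84\<close>.  All these estimates are equalities for \<open>\<phi> = \<i>\<close>, that is for
  \<open>g \<zeta> = \<zeta> / (1 - \<i> \<zeta>)^2\<close>, a rotation of the Koebe function for which the terms in each factor
  point in the same direction.  It is realised on \<open>X\<close> by \<open>f z = 1 / (1 - \<i> l z)^2\<close>, where \<open>l\<close> is a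
  norm-one functional attaining its norm.  Such functionals are also what makes the starlikeness
  condition nonvoid; they are obtained by the Hahn-Banach argument of \<open>support_functionals_nonempty\<close>.

  The analytic point is that the iterated derivatives in the definitions of \<open>A2\<close>, \<open>A3\<close> and \<open>A4\<close> exist in
  operator norm, whereas holomorphy is only differentiability at each point.  This rests on the formula
  \<open>DG(y) w = \<integral> 2 cos (2 \<pi> t) G (y + e^(2 \<pi> \<i> t) w) dt\<close> over \<open>[0, 1]\<close>.  For \<open>F\<close> it is the Cauchy formula
  on one-dimensional slices (lemma \<open>mean_differentiable_scaleC_ident\<close>), and if \<open>G\<close> satisfies it then
  \<open>DG\<close> is again differentiable and satisfies it (lemma \<open>mean_differentiable_fderiv\<close>).
\<close>

section \<open>Differentiability of all orders from a mean value formula\<close>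

lemma bounded_bilinear_scaleC:
  "bounded_bilinear (scaleC :: complex \<Rightarrow> 'a::complex_normed_vector \<Rightarrow> 'a)"
proof
  fix a a' :: complex and b b' :: 'a and r :: real
  show "(a + a') *\<^sub>C b = a *\<^sub>C b + a' *\<^sub>C b" by (rule scaleC_add_left)
  show "a *\<^sub>C (b + b') = a *\<^sub>C b + a *\<^sub>C b'" by (rule scaleC_add_right)
  show "(r *\<^sub>R a) *\<^sub>C b = r *\<^sub>R (a *\<^sub>C b)"
    by (simp add: scaleR_conv_of_real flip: scaleC_of_real scaleC_scaleC)
  show "a *\<^sub>C (r *\<^sub>R b) = r *\<^sub>R (a *\<^sub>C b)"
    by (simp flip: scaleC_of_real add: scaleC_scaleC mult.commute)
  show "\<exists>K. \<forall>(a::complex) (b::'a). norm (a *\<^sub>C b) \<le> norm a * norm b * K"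
    by (rule exI[of _ 1]) (simp add: norm_scaleC)
qed

interpretation scaleC: bounded_bilinear "scaleC :: complex \<Rightarrow> 'a::complex_normed_vector \<Rightarrow> 'a"
  by (rule bounded_bilinear_scaleC)

lemma norm_on_circle_le: "norm (y + cis t *\<^sub>C w) \<le> norm y + norm w"
  by (rule order_trans[OF norm_triangle_ineq]) (simp add: norm_scaleC)

lemma linear_bound_from_sphere:
  assumes f: "linear f" and r: "0 < r" and b: "\<And>w. norm w = r \<Longrightarrow> norm (f w) \<le> C"
  shows "norm (f w) \<le> C / r * norm w"
proof (cases "w = 0")
  case True
  then show ?thesis by (simp add: linear_0[OF f])
next
  case False
  have "norm (f ((r / norm w) *\<^sub>R w)) \<le> C" by (rule b) (use False r in simp)
  then show ?thesis using False r by (simp add: linear_cmul[OF f] field_simps)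
qed

lemma norm_blinfun_le_from_sphere:
  assumes "0 < r" "0 \<le> C" "\<And>w. norm w = r \<Longrightarrow> norm (blinfun_apply L w) \<le> C"
  shows "norm L \<le> C / r"
proof (rule norm_blinfun_bound)
  show "0 \<le> C / r" using assms by simp
  show "norm (blinfun_apply L x) \<le> C / r * norm x" for x
    by (rule linear_bound_from_sphere[OF _ assms(1,3)]) (auto intro: bounded_linear.linear blinfun.bounded_linear_right)
qed

text \<open>
  The Cauchy formula for a derivative uses the kernel \<open>exp (- 2 \<pi> \<i> t)\<close>, which requires scalars acting
  on the values of \<open>G\<close>.  The real kernel \<open>2 cos (2 \<pi> t)\<close> also picks up the Fourier coefficient of index
  \<open>-1\<close>, which vanishes for holomorphic functions.  With it the spaces of real-linear bounded operators,
  in which the iterated derivatives live, need no complex structure.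
\<close>

definition circle_mean :: "('a::complex_normed_vector \<Rightarrow> 'b::banach) \<Rightarrow> 'a \<Rightarrow> 'a \<Rightarrow> 'b"
  where "circle_mean G y w =
    integral {0..1} (\<lambda>t. (2 * cos (2 * pi * t)) *\<^sub>R G (y + cis (2 * pi * t) *\<^sub>C w))"

lemma continuous_on_circle:
  fixes G :: "'a::complex_normed_vector \<Rightarrow> 'b::real_normed_vector"
  assumes G: "continuous_on (ball 0 1) G" and yw: "norm y + norm w < 1"
  shows "continuous_on S (\<lambda>t. (2 * cos (2 * pi * t)) *\<^sub>R G (y + cis (2 * pi * t) *\<^sub>C w))"
proof -
  have "continuous_on S (\<lambda>t. y + cis (2 * pi * t) *\<^sub>C w)"
    by (intro continuous_on_add continuous_on_const scaleC.continuous_on continuous_on_cis continuous_intros)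
  then have "continuous_on S (\<lambda>t. G (y + cis (2 * pi * t) *\<^sub>C w))"
    by (rule continuous_on_compose2[OF G])
      (auto intro: le_less_trans[OF norm_on_circle_le yw])
  then show ?thesis by (auto intro!: continuous_intros)
qed

lemma has_integral_circle_mean:
  assumes "continuous_on (ball 0 1) G" "norm y + norm w < 1"
  shows "((\<lambda>t. (2 * cos (2 * pi * t)) *\<^sub>R G (y + cis (2 * pi * t) *\<^sub>C w)) has_integral circle_mean G y w) {0..1}"
  unfolding circle_mean_def
  by (rule integrable_integral[OF integrable_continuous_real[OF continuous_on_circle[OF assms]]])

lemma norm_circle_integral_le:
  fixes H :: "real \<Rightarrow> 'b::banach"
  assumes "((\<lambda>t. (2 * cos (2 * pi * t)) *\<^sub>R H t) has_integral I) {0..1}"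
    and "0 \<le> M" "\<And>t. norm (H t) \<le> M"
  shows "norm I \<le> 2 * M"
proof -
  have "norm I \<le> (2 * M) * measure lborel (cbox 0 (1::real))"
  proof (rule has_integral_bound)
    fix t :: real
    have "\<bar>2 * cos (2 * pi * t)\<bar> * norm (H t) \<le> 2 * M"
      using assms by (intro mult_mono) (auto simp: abs_mult)
    then show "norm ((2 * cos (2 * pi * t)) *\<^sub>R H t) \<le> 2 * M" by simp
  qed (use assms in auto)
  then show ?thesis by simp
qed

lemma norm_circle_mean_le:
  assumes "continuous_on (ball 0 1) G" "norm y + norm w < 1" "0 \<le> M"
    and "\<And>t. norm (G (y + cis t *\<^sub>C w)) \<le> M"
  shows "norm (circle_mean G y w) \<le> 2 * M"
  by (rule norm_circle_integral_le[OF has_integral_circle_mean[OF assms(1,2)] assms(3)]) (rule assms(4))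

text \<open>
  Differentiability together with the Cauchy formula: a form of holomorphy that can be passed on
  to the derivative.
\<close>

definition mean_differentiable :: "('a::complex_normed_vector \<Rightarrow> 'b::banach) \<Rightarrow> bool"
  where "mean_differentiable G \<longleftrightarrow>
    (\<forall>y\<in>ball 0 1. G differentiable (at y)) \<and>
    (\<forall>y w. norm y + norm w < 1 \<longrightarrow> blinfun_apply (fderiv G y) w = circle_mean G y w)"

lemma mean_differentiableD:
  assumes "mean_differentiable G"
  shows "y \<in> ball 0 1 \<Longrightarrow> (G has_derivative blinfun_apply (fderiv G y)) (at y)"
    and "norm y + norm w < 1 \<Longrightarrow> blinfun_apply (fderiv G y) w = circle_mean G y w"
    and "continuous_on (ball 0 1) G"
proof -
  show *: "y \<in> ball 0 1 \<Longrightarrow> (G has_derivative blinfun_apply (fderiv G y)) (at y)" for y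
    using assms fderiv_eqI[of G _ y] unfolding mean_differentiable_def differentiable_def by metis
  show "norm y + norm w < 1 \<Longrightarrow> blinfun_apply (fderiv G y) w = circle_mean G y w"
    using assms by (auto simp: mean_differentiable_def)
  show "continuous_on (ball 0 1) G"
    using * has_derivative_continuous continuous_at_imp_continuous_on by blast
qed

text \<open>
  The usual chain of Cauchy estimates.  Continuity bounds \<open>G\<close> near \<open>z0\<close>; the mean value formula turns a
  bound on \<open>G\<close> into a bound on \<open>DG\<close>, hence \<open>G\<close> is Lipschitz; the formula applied to a difference of
  two translates of \<open>G\<close> turns this into a Lipschitz bound for \<open>DG\<close>; and this gives a Taylor remainder
  of second order, uniformly in the base point.
\<close>

lemma mean_differentiable_local_bounds:
  fixes G :: "'a::complex_normed_vector \<Rightarrow> 'b::banach"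
  assumes G: "mean_differentiable G" and z0: "norm z0 < 1"
  obtains \<delta> K where "0 < \<delta>" "norm z0 + 2 * \<delta> < 1" "0 \<le> K"
    "\<And>y. y \<in> ball z0 \<delta> \<Longrightarrow> norm (fderiv G y) \<le> K"
    "\<And>y y'. y \<in> ball z0 \<delta> \<Longrightarrow> y' \<in> ball z0 \<delta> \<Longrightarrow> norm (fderiv G y - fderiv G y') \<le> K * norm (y - y')"
    "\<And>y h. y \<in> ball z0 \<delta> \<Longrightarrow> y + h \<in> ball z0 \<delta> \<Longrightarrow>
        norm (G (y + h) - G y - blinfun_apply (fderiv G y) h) \<le> K * (norm h)\<^sup>2"
proof -
  note der = mean_differentiableD(1)[OF G] and mean = mean_differentiableD(2)[OF G]
    and cont = mean_differentiableD(3)[OF G]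
  have "isCont G z0" using cont z0 by (simp add: continuous_on_eq_continuous_at)
  then obtain d where d: "d > 0" "\<And>x. dist x z0 < d \<Longrightarrow> dist (G x) (G z0) < 1"
    unfolding continuous_at_eps_delta by (meson zero_less_one)
  define M where "M = norm (G z0) + 1"
  have M: "0 \<le> M" by (simp add: M_def)
  have GM: "norm (G x) \<le> M" if "dist x z0 < d" for x
    using d(2)[OF that] norm_triangle_sub[of "G x" "G z0"] by (simp add: M_def dist_norm)
  define \<delta> where "\<delta> = min d (1 - norm z0) / 4"
  have \<delta>: "0 < \<delta>" "4 * \<delta> \<le> d" "norm z0 + 4 * \<delta> \<le> 1" using d(1) z0 by (auto simp: \<delta>_def)
  have nb: "norm y < norm z0 + e" if "y \<in> ball z0 e" for y e
    using that norm_triangle_sub[of y z0] by (simp add: dist_norm norm_minus_commute)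
  have circ: "dist (y + cis t *\<^sub>C w) z0 \<le> dist z0 y + norm w" for y t w
    using norm_on_circle_le[of "y - z0" t w] by (simp add: dist_norm norm_minus_commute algebra_simps)
  define L where "L = 2 * M / \<delta>"
  have L: "0 \<le> L" using M \<delta> by (simp add: L_def)
  have D: "norm (fderiv G y) \<le> L" if y: "y \<in> ball z0 (2 * \<delta>)" for y
    unfolding L_def
  proof (rule norm_blinfun_le_from_sphere)
    fix w :: 'a assume w: "norm w = \<delta>"
    have small: "norm y + norm w < 1" using nb[OF y] w \<delta> by simp
    show "norm (blinfun_apply (fderiv G y) w) \<le> 2 * M"
      unfolding mean[OF small]
    proof (rule norm_circle_mean_le[OF cont small M])
      show "norm (G (y + cis t *\<^sub>C w)) \<le> M" for t
        using circ[of y t w] y w \<delta> by (intro GM) auto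
    qed
  qed (use M \<delta> in auto)
  have lip: "norm (G x - G y) \<le> L * norm (x - y)" if "x \<in> ball z0 (2 * \<delta>)" "y \<in> ball z0 (2 * \<delta>)" for x y
  proof (rule differentiable_bound[of "ball z0 (2 * \<delta>)" G "\<lambda>x. blinfun_apply (fderiv G x)"])
    fix v assume v: "v \<in> ball z0 (2 * \<delta>)"
    have "v \<in> ball 0 1" using nb[OF v] \<delta> by simp
    then show "(G has_derivative blinfun_apply (fderiv G v)) (at v within ball z0 (2 * \<delta>))"
      by (rule has_derivative_at_withinI[OF der])
    show "onorm (blinfun_apply (fderiv G v)) \<le> L" using D[OF v] by (simp add: norm_blinfun.rep_eq)
  qed (use that in auto)
  define K where "K = max L (2 * L / \<delta>)"
  have K: "0 \<le> K" "L \<le> K" "2 * L / \<delta> \<le> K" using L by (auto simp: K_def)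
  have Dlip: "norm (fderiv G y - fderiv G y') \<le> K * norm (y - y')"
    if y: "y \<in> ball z0 \<delta>" "y' \<in> ball z0 \<delta>" for y y'
  proof -
    have "norm (fderiv G y - fderiv G y') \<le> (2 * (L * norm (y - y'))) / \<delta>"
    proof (rule norm_blinfun_le_from_sphere)
      fix w :: 'a assume w: "norm w = \<delta>"
      have small: "norm y + norm w < 1" "norm y' + norm w < 1" using nb[OF y(1)] nb[OF y(2)] w \<delta> by auto
      have "((\<lambda>t. (2 * cos (2 * pi * t)) *\<^sub>R
          (G (y + cis (2 * pi * t) *\<^sub>C w) - G (y' + cis (2 * pi * t) *\<^sub>C w))) has_integral
          (circle_mean G y w - circle_mean G y' w)) {0..1}"
        using has_integral_diff[OF has_integral_circle_mean[OF cont small(1)] has_integral_circle_mean[OF cont small(2)]]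
        by (simp add: scaleR_diff_right)
      then have "norm (circle_mean G y w - circle_mean G y' w) \<le> 2 * (L * norm (y - y'))"
      proof (rule norm_circle_integral_le)
        fix t
        have "norm (G (y + cis (2 * pi * t) *\<^sub>C w) - G (y' + cis (2 * pi * t) *\<^sub>C w))
            \<le> L * norm ((y + cis (2 * pi * t) *\<^sub>C w) - (y' + cis (2 * pi * t) *\<^sub>C w))"
          by (rule lip) (use circ[of y "2 * pi * t" w] circ[of y' "2 * pi * t" w] y w in \<open>auto simp: dist_commute\<close>)
        then show "norm (G (y + cis (2 * pi * t) *\<^sub>C w) - G (y' + cis (2 * pi * t) *\<^sub>C w)) \<le> L * norm (y - y')"
          by simp
      qed (use L in simp)
      then show "norm (blinfun_apply (fderiv G y - fderiv G y') w) \<le> 2 * (L * norm (y - y'))"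
        by (simp add: blinfun.diff_left mean small)
    qed (use L \<delta> in auto)
    also have "\<dots> = 2 * L / \<delta> * norm (y - y')" by simp
    also have "\<dots> \<le> K * norm (y - y')" by (rule mult_right_mono[OF K(3)]) simp
    finally show ?thesis .
  qed
  show thesis
  proof (rule that[of \<delta> K])
    show "0 < \<delta>" "norm z0 + 2 * \<delta> < 1" "0 \<le> K" using \<delta> K by auto
    show "norm (fderiv G y) \<le> K" if "y \<in> ball z0 \<delta>" for y
      using order_trans[OF D K(2)] that \<delta> by auto
    show "norm (fderiv G y - fderiv G y') \<le> K * norm (y - y')"
      if "y \<in> ball z0 \<delta>" "y' \<in> ball z0 \<delta>" for y y' using Dlip that by blast
    show "norm (G (y + h) - G y - blinfun_apply (fderiv G y) h) \<le> K * (norm h)\<^sup>2"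
      if y: "y \<in> ball z0 \<delta>" and yh: "y + h \<in> ball z0 \<delta>" for y h
    proof -
      define S where "S = closed_segment y (y + h)"
      have S: "S \<subseteq> ball z0 \<delta>" unfolding S_def using closed_segment_subset[OF y yh convex_ball] .
      have "norm (G (y + h) - G y - blinfun_apply (fderiv G y) ((y + h) - y)) \<le> norm ((y + h) - y) * (K * norm h)"
      proof (rule differentiable_bound_linearization[where S = S and f' = "\<lambda>x. blinfun_apply (fderiv G x)"])
        show "y + t *\<^sub>R (y + h - y) \<in> S" if "t \<in> {0..1}" for t
          using that unfolding S_def closed_segment_def by (auto intro!: exI[of _ t] simp: algebra_simps)
        show "y \<in> S" by (simp add: S_def)
        fix x assume x: "x \<in> S"
        then have xb: "x \<in> ball z0 \<delta>" using S by auto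
        then have "x \<in> ball 0 1" using nb[OF xb] \<delta> by simp
        then show "(G has_derivative blinfun_apply (fderiv G x)) (at x within S)"
          by (rule has_derivative_at_withinI[OF der])
        have "onorm (\<lambda>v. blinfun_apply (fderiv G x) v - blinfun_apply (fderiv G y) v) = norm (fderiv G x - fderiv G y)"
          by (simp add: norm_blinfun.rep_eq minus_blinfun.rep_eq)
        also have "\<dots> \<le> K * norm (x - y)" by (rule Dlip[OF xb y])
        also have "\<dots> \<le> K * norm h"
          using x K(1) unfolding S_def closed_segment_def
          by (intro mult_left_mono) (auto simp: algebra_simps mult_left_le_one_le)
        finally show "onorm (blinfun_apply (fderiv G x) - blinfun_apply (fderiv G y)) \<le> K * norm h"
          by (simp add: fun_diff_def)
      qed
      then show ?thesis by (simp add: power2_eq_square mult_ac)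
    qed
  qed
qed

lemma continuous_on_fderiv:
  assumes G: "mean_differentiable G"
  shows "continuous_on (ball 0 1) (fderiv G)"
proof -
  have "isCont (fderiv G) z" if z: "norm z < 1" for z
  proof -
    obtain \<delta> K where dk: "0 < \<delta>" "0 \<le> K"
      "\<And>y y'. y \<in> ball z \<delta> \<Longrightarrow> y' \<in> ball z \<delta> \<Longrightarrow> norm (fderiv G y - fderiv G y') \<le> K * norm (y - y')"
      using mean_differentiable_local_bounds[OF G z] by metis
    have "K-lipschitz_on (ball z \<delta>) (fderiv G)"
      using dk by (intro lipschitz_onI) (auto simp: dist_norm)
    then have "continuous_on (ball z \<delta>) (fderiv G)" by (rule lipschitz_on_continuous_on)
    then show ?thesis using dk(1) by (simp add: continuous_on_eq_continuous_at)
  qed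
  then show ?thesis by (intro continuous_at_imp_continuous_on) auto
qed

lemma circle_mean_fderiv_apply:
  assumes G: "mean_differentiable G" and s: "norm z + norm w < 1"
  shows "((\<lambda>t. (2 * cos (2 * pi * t)) *\<^sub>R blinfun_apply (fderiv G (z + cis (2 * pi * t) *\<^sub>C w)) h)
           has_integral blinfun_apply (circle_mean (fderiv G) z w) h) {0..1}"
  using has_integral_linear[OF has_integral_circle_mean[OF continuous_on_fderiv[OF G] s] blinfun.bounded_linear_left[of h]]
  by (simp add: o_def blinfun.scaleR_left)

text \<open>
  The symmetry of the second derivative.  Both sides are the same double integral of \<open>G\<close> over a torus,
  with the order of integration exchanged.
\<close>

lemma circle_mean_fderiv_symmetric:
  assumes G: "mean_differentiable G" and s: "norm z + norm w + norm h < 1"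
  shows "blinfun_apply (circle_mean (fderiv G) z w) h = blinfun_apply (circle_mean (fderiv G) z h) w"
proof -
  define \<Phi> where "\<Phi> v x t r = (2 * cos (2 * pi * t)) *\<^sub>R (2 * cos (2 * pi * r)) *\<^sub>R
       G (z + cis (2 * pi * t) *\<^sub>C v + cis (2 * pi * r) *\<^sub>C x)" for v x t r
  have \<Phi>_eq: "\<Phi> v x t = (\<lambda>r. (2 * cos (2 * pi * t)) *\<^sub>R ((2 * cos (2 * pi * r)) *\<^sub>R
       G (z + cis (2 * pi * t) *\<^sub>C v + cis (2 * pi * r) *\<^sub>C x)))" for v x t
    by (simp add: \<Phi>_def fun_eq_iff)
  have eq: "blinfun_apply (circle_mean (fderiv G) z v) x =
      integral {0..1} (\<lambda>t. integral {0..1} (\<Phi> v x t))" if s: "norm z + norm v + norm x < 1" for v x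
  proof -
    have "norm z + norm v < 1" using s norm_ge_zero[of x] by linarith
    from integral_unique[OF circle_mean_fderiv_apply[OF G this, of x]]
    have "blinfun_apply (circle_mean (fderiv G) z v) x = integral {0..1}
       (\<lambda>t. (2 * cos (2 * pi * t)) *\<^sub>R blinfun_apply (fderiv G (z + cis (2 * pi * t) *\<^sub>C v)) x)"
      by simp
    also have "\<dots> = integral {0..1} (\<lambda>t. integral {0..1} (\<Phi> v x t))"
    proof (rule integral_cong)
      fix t
      have "norm (z + cis (2 * pi * t) *\<^sub>C v) + norm x < 1"
        using norm_on_circle_le[of z "2 * pi * t" v] s by linarith
      from mean_differentiableD(2)[OF G this]
      show "(2 * cos (2 * pi * t)) *\<^sub>R blinfun_apply (fderiv G (z + cis (2 * pi * t) *\<^sub>C v)) x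
          = integral {0..1} (\<Phi> v x t)"
        by (simp only: \<Phi>_eq circle_mean_def integral_cmul)
    qed
    finally show ?thesis .
  qed
  have "continuous_on (cbox (0, 0) (1, 1)) (\<lambda>(t, r). \<Phi> w h t r)"
  proof -
    let ?p = "\<lambda>p. z + cis (2 * pi * fst p) *\<^sub>C w + cis (2 * pi * snd p) *\<^sub>C h"
    have "continuous_on (cbox (0, 0) (1, 1)) ?p"
      by (intro continuous_on_add continuous_on_const scaleC.continuous_on continuous_on_cis continuous_intros)
    moreover have "?p (a, b) \<in> ball 0 1" for a b
      using norm_on_circle_le[of "z + cis (2 * pi * a) *\<^sub>C w" "2 * pi * b" h]
        norm_on_circle_le[of z "2 * pi * a" w] s by simp
    ultimately have "continuous_on (cbox (0, 0) (1, 1)) (\<lambda>p. G (?p p))"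
      by (intro continuous_on_compose2[OF mean_differentiableD(3)[OF G]]) auto
    then show ?thesis unfolding \<Phi>_def split_beta by (auto intro!: continuous_intros)
  qed
  from integral_swap_continuous[OF this]
  have "integral {0..1} (\<lambda>t. integral {0..1} (\<Phi> w h t)) = integral {0..1} (\<lambda>r. integral {0..1} (\<lambda>t. \<Phi> w h t r))"
    by (simp add: eta_contract_eq)
  also have "(\<lambda>r t. \<Phi> w h t r) = \<Phi> h w"
    by (intro ext) (simp add: \<Phi>_def algebra_simps)
  then have "integral {0..1} (\<lambda>r. integral {0..1} (\<lambda>t. \<Phi> w h t r)) = integral {0..1} (\<lambda>r. integral {0..1} (\<Phi> h w r))"
    by (metis (no_types))
  finally show ?thesis using eq[of w h] eq[of h w] s by (simp add: algebra_simps)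
qed

text \<open>
  The candidate for the derivative of \<open>DG\<close> at \<open>z\<close> in direction \<open>w\<close> is \<open>U w = circle_mean (fderiv G) z w\<close>.
  As \<open>U w\<close> is an operator, \<open>U w h\<close> is linear in \<open>h\<close>; by symmetry \<open>U w\<close> is additive and homogeneous in \<open>w\<close>
  where the integral stays in the unit ball, and it extends by scaling to a linear map \<open>B\<close>.
  Integrating the second order Taylor remainder of \<open>G\<close> over the circle \<open>z + e^(2 \<pi> \<i> t) w\<close> bounds
  \<open>(DG(z + h) - DG(z) - B h) w\<close> by a multiple of \<open>\<parallel>h\<parallel>^2\<close>, uniformly for \<open>w\<close> on a sphere; this is
  differentiability in operator norm.
\<close>

lemma mean_differentiable_fderiv:
  fixes G :: "'a::complex_normed_vector \<Rightarrow> 'b::banach"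
  assumes G: "mean_differentiable G"
  shows "mean_differentiable (fderiv G)"
proof -
  have main: "\<exists>B. (fderiv G has_derivative B) (at z) \<and>
      (\<forall>w. norm z + norm w < 1 \<longrightarrow> B w = circle_mean (fderiv G) z w)" if z: "norm z < 1" for z
  proof -
    note mean = mean_differentiableD(2)[OF G] and cont = mean_differentiableD(3)[OF G]
    define U where "U = circle_mean (fderiv G) z"
    have sym: "blinfun_apply (U w) h = blinfun_apply (U h) w" if "norm z + norm w + norm h < 1" for w h
      unfolding U_def by (rule circle_mean_fderiv_symmetric[OF G that])
    define \<epsilon> where "\<epsilon> = (1 - norm z) / 2"
    have \<epsilon>: "0 < \<epsilon>" "norm z + 2 * \<epsilon> = 1" using z by (auto simp: \<epsilon>_def field_simps)
    have shrink: "\<exists>\<sigma>>0. \<sigma> * norm (h::'a) < e" if "0 < e" for h e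
      by (rule exI[of _ "e / (1 + norm h)"]) (use that in \<open>simp add: field_simps add_pos_nonneg\<close>)
    (* the factor by which w is shrunk into the domain of U; any admissible factor gives the same B w *)
    define c where "c w = (SOME \<sigma>. 0 < \<sigma> \<and> \<sigma> * norm (w::'a) < \<epsilon>)" for w
    have c: "0 < c w" "c w * norm w < \<epsilon>" for w
      using someI_ex[OF shrink[OF \<epsilon>(1), of w, unfolded Bex_def]] by (auto simp: c_def)
    define B where "B w = (1 / c w) *\<^sub>R U (c w *\<^sub>R w)" for w
    have B: "blinfun_apply (B w) h = (1 / \<sigma>) *\<^sub>R blinfun_apply (U (\<sigma> *\<^sub>R h)) w"
      if \<sigma>: "0 < \<sigma>" "\<sigma> * norm h < \<epsilon>" for w h \<sigma>
    proof -
      have "blinfun_apply (U (c w *\<^sub>R w)) (\<sigma> *\<^sub>R h) = blinfun_apply (U (\<sigma> *\<^sub>R h)) (c w *\<^sub>R w)"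
        by (rule sym) (use \<sigma> c[of w] \<epsilon> in simp)
      then have "(1 / (\<sigma> * c w)) *\<^sub>R \<sigma> *\<^sub>R blinfun_apply (U (c w *\<^sub>R w)) h =
          (1 / (\<sigma> * c w)) *\<^sub>R c w *\<^sub>R blinfun_apply (U (\<sigma> *\<^sub>R h)) w"
        by (simp only: blinfun.scaleR_right)
      then show ?thesis
        using \<sigma> c(1)[of w] by (simp add: B_def blinfun.scaleR_left)
    qed
    have BU: "B w = U w" if w: "norm z + norm w < 1" for w
    proof (rule blinfun_eqI)
      fix h :: 'a
      obtain \<sigma> where \<sigma>: "0 < \<sigma>" "\<sigma> * norm h < min \<epsilon> (1 - norm z - norm w)"
        using shrink[of "min \<epsilon> (1 - norm z - norm w)" h] w \<epsilon> by auto
      have "blinfun_apply (U (\<sigma> *\<^sub>R h)) w = blinfun_apply (U w) (\<sigma> *\<^sub>R h)"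
        by (rule sym) (use \<sigma> in simp)
      then show "blinfun_apply (B w) h = blinfun_apply (U w) h"
        using B[of \<sigma> h w] \<sigma> by (simp add: blinfun.scaleR_right)
    qed
    have lin: "linear B"
    proof (rule linearI; rule blinfun_eqI)
      fix x y h :: 'a and r :: real
      obtain \<sigma> where \<sigma>: "0 < \<sigma>" "\<sigma> * norm h < \<epsilon>" using shrink[OF \<epsilon>(1), of h] by auto
      show "blinfun_apply (B (x + y)) h = blinfun_apply (B x + B y) h"
        unfolding blinfun.add_left B[OF \<sigma>] by (simp add: blinfun.bilinear_simps scaleR_add_right)
      show "blinfun_apply (B (r *\<^sub>R x)) h = blinfun_apply (r *\<^sub>R B x) h"
        unfolding blinfun.scaleR_left B[OF \<sigma>] by (simp add: blinfun.bilinear_simps)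
    qed
    obtain \<delta> K where \<delta>: "0 < \<delta>" "norm z + 2 * \<delta> < 1" and K: "0 \<le> K"
      and DK: "\<And>y. y \<in> ball z \<delta> \<Longrightarrow> norm (fderiv G y) \<le> K"
      and T: "\<And>y h. y \<in> ball z \<delta> \<Longrightarrow> y + h \<in> ball z \<delta> \<Longrightarrow>
        norm (G (y + h) - G y - blinfun_apply (fderiv G y) h) \<le> K * (norm h)\<^sup>2"
      using mean_differentiable_local_bounds[OF G z] by metis
    have onc: "z + cis t *\<^sub>C w \<in> ball z \<delta>" if "norm w = \<delta> / 2" for t and w :: 'a
      using that \<delta> by (simp add: dist_norm norm_scaleC)
    have "norm (B w) \<le> 2 * K / (\<delta> / 2) * norm w" for w
    proof (rule linear_bound_from_sphere[OF lin])
      fix w :: 'a assume w: "norm w = \<delta> / 2"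
      have small: "norm z + norm w < 1" using w \<delta> by simp
      show "norm (B w) \<le> 2 * K"
        unfolding BU[OF small] U_def
        by (rule norm_circle_mean_le[OF continuous_on_fderiv[OF G] small K]) (rule DK[OF onc[OF w]])
    qed (use \<delta> in simp)
    then have bl: "bounded_linear B"
      using lin by (intro bounded_linear_intro[where K = "2 * K / (\<delta> / 2)"])
        (auto simp: linear_add linear_cmul mult.commute)
    have est: "norm (fderiv G (z + h) - fderiv G z - B h) \<le> 2 * (K * (norm h)\<^sup>2) / (\<delta> / 2)"
      if h: "norm h < \<delta> / 2" for h
    proof (rule norm_blinfun_le_from_sphere)
      fix w :: 'a assume w: "norm w = \<delta> / 2"
      have small: "norm z + norm w < 1" "norm (z + h) + norm w < 1" "norm z + norm h < 1" "norm z + norm h + norm w < 1"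
        using w \<delta> h norm_triangle_ineq[of z h] by auto
      have "blinfun_apply (B h) w = blinfun_apply (U w) h"
        using BU[OF small(3)] sym[OF small(4)] by simp
      then have Bh: "((\<lambda>t. (2 * cos (2 * pi * t)) *\<^sub>R blinfun_apply (fderiv G (z + cis (2 * pi * t) *\<^sub>C w)) h)
           has_integral blinfun_apply (B h) w) {0..1}"
        using circle_mean_fderiv_apply[OF G small(1), of h] by (simp add: U_def)
      have "((\<lambda>t. (2 * cos (2 * pi * t)) *\<^sub>R (G ((z + cis (2 * pi * t) *\<^sub>C w) + h) - G (z + cis (2 * pi * t) *\<^sub>C w)
           - blinfun_apply (fderiv G (z + cis (2 * pi * t) *\<^sub>C w)) h)) has_integral
          (circle_mean G (z + h) w - circle_mean G z w - blinfun_apply (B h) w)) {0..1}"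
        using has_integral_diff[OF has_integral_diff[OF has_integral_circle_mean[OF cont small(2)]
              has_integral_circle_mean[OF cont small(1)]] Bh]
        by (simp add: scaleR_diff_right add_ac)
      then have "norm (circle_mean G (z + h) w - circle_mean G z w - blinfun_apply (B h) w) \<le> 2 * (K * (norm h)\<^sup>2)"
      proof (rule norm_circle_integral_le)
        fix t
        have "dist z (z + cis (2 * pi * t) *\<^sub>C w + h) \<le> norm w + norm h"
          using norm_on_circle_le[of h "2 * pi * t" w] norm_minus_cancel[of "h + cis (2 * pi * t) *\<^sub>C w"]
          by (simp add: dist_norm algebra_simps)
        then show "norm (G ((z + cis (2 * pi * t) *\<^sub>C w) + h) - G (z + cis (2 * pi * t) *\<^sub>C w)
           - blinfun_apply (fderiv G (z + cis (2 * pi * t) *\<^sub>C w)) h) \<le> K * (norm h)\<^sup>2"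
          using onc[OF w] w h by (intro T) auto
      qed (use K in simp)
      then show "norm (blinfun_apply (fderiv G (z + h) - fderiv G z - B h) w) \<le> 2 * (K * (norm h)\<^sup>2)"
        by (simp add: blinfun.diff_left mean small)
    qed (use \<delta> K in auto)
    have "(fderiv G has_derivative B) (at z)"
    proof (rule has_derivativeI_sandwich[where e = "\<delta> / 2"])
      show "0 < \<delta> / 2" using \<delta> by simp
      show "bounded_linear B" by (rule bl)
      fix y assume y: "y \<noteq> z" "dist y z < \<delta> / 2"
      have "norm (fderiv G y - fderiv G z - B (y - z)) \<le> 2 * (K * (norm (y - z))\<^sup>2) / (\<delta> / 2)"
        using est[of "y - z"] y by (simp add: dist_norm)
      then show "norm (fderiv G y - fderiv G z - B (y - z)) / norm (y - z) \<le> 4 * K / \<delta> * norm (y - z)"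
        using y(1) \<delta>(1) by (simp add: field_simps power2_eq_square)
    next
      have "((\<lambda>y. 4 * K / \<delta> * norm (y - z)) \<longlongrightarrow> 4 * K / \<delta> * norm (z - z)) (at z)"
        by (intro tendsto_intros)
      then show "((\<lambda>y. 4 * K / \<delta> * norm (y - z)) \<longlongrightarrow> 0) (at z)" by simp
    qed
    then show ?thesis using BU U_def by auto
  qed
  show ?thesis
    unfolding mean_differentiable_def
  proof (intro conjI ballI allI impI)
    fix y :: 'a assume "y \<in> ball 0 1"
    then show "fderiv G differentiable (at y)" using main[of y] by (auto simp: differentiable_def)
  next
    fix y w :: 'a assume s: "norm y + norm w < 1"
    then have "norm y < 1" using norm_ge_zero[of w] by linarith
    then obtain B where "(fderiv G has_derivative B) (at y)" "B w = circle_mean (fderiv G) y w"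
      using main[of y] s by auto
    then show "blinfun_apply (fderiv (fderiv G) y) w = circle_mean (fderiv G) y w"
      by (simp add: fderiv_eqI)
  qed
qed

section \<open>The maps \<open>z \<mapsto> f z *\<^sub>C z\<close> and their Taylor coefficients along a line\<close>

text \<open>
  On the unit circle \<open>2 cos (2 \<pi> t) = c + 1 / c\<close> with \<open>c = exp (2 \<pi> \<i> t)\<close>.  The summand \<open>1 / c\<close> gives the
  Cauchy formula for the derivative at 0, and the summand \<open>c\<close> contributes the integral of \<open>k\<close> over a
  closed contour, which is 0.
\<close>

lemma cauchy_derivative_circle:
  assumes k: "k holomorphic_on ball 0 R" and R: "1 < R"
  shows "((\<lambda>t. (2 * cos (2 * pi * t)) *\<^sub>R k (cis (2 * pi * t))) has_integral deriv k 0) {0..1}"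
proof -
  have sub: "cball 0 1 \<subseteq> ball (0::complex) R" using R by auto
  have hol: "k holomorphic_on ball 0 1" and cont: "continuous_on (cball 0 1) k"
    using sub k holomorphic_on_subset holomorphic_on_imp_continuous_on continuous_on_subset ball_subset_cball
    by (metis order_trans, blast)
  have e: "exp (2 * of_real pi * \<i> * of_real t) = cis (2 * pi * t)" for t
    by (simp add: cis_conv_exp mult_ac)
  have path: "(f has_contour_integral I) (circlepath 0 1) \<longleftrightarrow>
      ((\<lambda>t. f (cis (2 * pi * t)) * (2 * of_real pi * \<i> * cis (2 * pi * t))) has_integral I) {0..1}" for f I
    unfolding has_contour_integral_def
  proof (rule has_integral_cong)
    fix t :: real assume "t \<in> {0..1}"
    then have "vector_derivative (circlepath 0 1) (at t within {0..1}) = 2 * of_real pi * \<i> * cis (2 * pi * t)"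
      using vector_derivative_circlepath01[of t 0 1] by (simp add: e)
    moreover have "circlepath 0 1 t = cis (2 * pi * t)" by (simp add: circlepath e)
    ultimately show "f (circlepath 0 1 t) * vector_derivative (circlepath 0 1) (at t within {0..1}) =
        f (cis (2 * pi * t)) * (2 * of_real pi * \<i> * cis (2 * pi * t))" by simp
  qed
  have "(k has_contour_integral 0) (circlepath 0 1)"
    by (rule Cauchy_theorem_convex_simple[OF k convex_ball]) (use sub in auto)
  then have 1: "((\<lambda>t. k (cis (2 * pi * t)) * (2 * of_real pi * \<i> * cis (2 * pi * t))) has_integral 0) {0..1}"
    by (simp only: path)
  have "((\<lambda>u. k u / (u - 0) ^ Suc 1) has_contour_integral (2 * pi * \<i> / fact 1 * (deriv ^^ 1) k 0)) (circlepath 0 1)"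
    by (rule Cauchy_has_contour_integral_higher_derivative_circlepath[OF cont hol]) simp
  then have 2: "((\<lambda>t. k (cis (2 * pi * t)) / (cis (2 * pi * t) - 0) ^ Suc 1 *
      (2 * of_real pi * \<i> * cis (2 * pi * t))) has_integral (2 * pi * \<i> / fact 1 * (deriv ^^ 1) k 0)) {0..1}"
    by (simp only: path)
  have "((\<lambda>t. (k (cis (2 * pi * t)) * (2 * of_real pi * \<i> * cis (2 * pi * t)) +
      k (cis (2 * pi * t)) / (cis (2 * pi * t) - 0) ^ Suc 1 * (2 * of_real pi * \<i> * cis (2 * pi * t))) * (1 / (2 * pi * \<i>)))
      has_integral (0 + 2 * pi * \<i> / fact 1 * (deriv ^^ 1) k 0) * (1 / (2 * pi * \<i>))) {0..1}"
    by (rule has_integral_mult_left[OF has_integral_add[OF 1 2]])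
  moreover have "(k c * (2 * of_real pi * \<i> * c) + k c / (c - 0) ^ Suc 1 * (2 * of_real pi * \<i> * c)) * (1 / (2 * pi * \<i>))
      = (c + 1 / c) * k c" if "c \<noteq> 0" for c
    using that by (simp add: field_simps)
  moreover have "cis x + 1 / cis x = of_real (2 * cos x)" for x
    by (simp add: complex_eq_iff inverse_eq_divide[symmetric] cis_inverse)
  ultimately show ?thesis by (simp add: scaleR_conv_of_real)
qed

lemma holomorphic_map_onD:
  assumes "holomorphic_map_on f (ball 0 1)" "norm z < 1"
  shows "(f has_derivative blinfun_apply (fderiv f z)) (at z)"
    and "bounded_clinear (blinfun_apply (fderiv f z))"
proof -
  have "z \<in> ball 0 1" using assms(2) by simp
  then obtain L where "bounded_clinear L" "(f has_derivative L) (at z)"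
    using assms(1) unfolding holomorphic_map_on_def by blast
  then show "(f has_derivative blinfun_apply (fderiv f z)) (at z)"
    and "bounded_clinear (blinfun_apply (fderiv f z))"
    by (simp_all add: fderiv_eqI)
qed

lemma holomorphic_map_on_slice:
  fixes f :: "'a::complex_normed_vector \<Rightarrow> complex"
  assumes f: "holomorphic_map_on f (ball 0 1)" and y: "norm (y + \<zeta> *\<^sub>C w) < 1"
  shows "((\<lambda>\<zeta>. f (y + \<zeta> *\<^sub>C w)) has_field_derivative blinfun_apply (fderiv f (y + \<zeta> *\<^sub>C w)) w) (at \<zeta>)"
proof -
  let ?p = "y + \<zeta> *\<^sub>C w"
  define L where "L = blinfun_apply (fderiv f (y + \<zeta> *\<^sub>C w))"
  have L: "bounded_clinear L" "(f has_derivative L) (at ?p)"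
    unfolding L_def using holomorphic_map_onD[OF f] y by auto
  have "((\<lambda>\<zeta>. y + \<zeta> *\<^sub>C w) has_derivative (\<lambda>c. c *\<^sub>C w)) (at \<zeta>)"
    by (auto intro!: derivative_eq_intros scaleC.bounded_linear_left[THEN bounded_linear.has_derivative])
  then have "((\<lambda>\<zeta>. f (y + \<zeta> *\<^sub>C w)) has_derivative (\<lambda>c. L (c *\<^sub>C w))) (at \<zeta>)"
    by (rule has_derivative_compose[where g = f]) (rule L(2))
  moreover have "(\<lambda>c. L (c *\<^sub>C w)) = (*) (L w)"
    using L(1) by (simp add: bounded_clinear_def scaleC_complex_def fun_eq_iff mult.commute)
  ultimately show ?thesis
    by (simp add: has_field_derivative_def fderiv_eqI[OF L(2)])
qed

lemma has_derivative_scaleC_ident: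
  fixes f :: "'a::complex_normed_vector \<Rightarrow> complex"
  assumes "(f has_derivative D) (at z)"
  shows "((\<lambda>z. f z *\<^sub>C z) has_derivative (\<lambda>w. f z *\<^sub>C w + D w *\<^sub>C z)) (at z)"
  using scaleC.FDERIV[OF assms has_derivative_ident] by simp

text \<open>
  On a slice \<open>F (y + \<zeta> w) = k \<zeta> y + (\<zeta> k \<zeta>) w\<close> with the scalar function \<open>k \<zeta> = f (y + \<zeta> w)\<close>.  So the
  scalar Cauchy formula, applied to \<open>k\<close> and to \<open>\<zeta> k\<close>, suffices for these vector-valued maps.
\<close>

lemma mean_differentiable_scaleC_ident:
  fixes f :: "'a::complex_banach \<Rightarrow> complex"
  assumes f: "holomorphic_map_on f (ball 0 1)"
  shows "mean_differentiable (\<lambda>z. f z *\<^sub>C z)"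
  unfolding mean_differentiable_def
proof (intro conjI ballI allI impI)
  fix y :: 'a assume "y \<in> ball 0 1"
  then show "(\<lambda>z. f z *\<^sub>C z) differentiable (at y)"
    using has_derivative_scaleC_ident[OF holomorphic_map_onD(1)[OF f, of y]] by (auto simp: differentiable_def)
next
  fix y w :: 'a assume s: "norm y + norm w < 1"
  then have y: "norm y < 1" using norm_ge_zero[of w] by linarith
  (* a radius larger than 1 for which the whole slice stays in the unit ball *)
  define R where "R = 2 - norm y - norm w"
  have R: "1 < R" using s by (simp add: R_def)
  define k where "k = (\<lambda>\<zeta>. f (y + \<zeta> *\<^sub>C w))"
  have inb: "norm (y + \<zeta> *\<^sub>C w) < 1" if "\<zeta> \<in> ball 0 R" for \<zeta>
  proof -
    have "norm (y + \<zeta> *\<^sub>C w) \<le> norm y + cmod \<zeta> * norm w"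
      by (rule order_trans[OF norm_triangle_ineq]) (simp add: norm_scaleC)
    also have "\<dots> \<le> norm y + R * norm w" using that by (intro add_left_mono mult_right_mono) auto
    also have "\<dots> = norm y + norm w + (1 - norm y - norm w) * norm w" by (simp add: R_def algebra_simps)
    also have "\<dots> < norm y + norm w + (1 - norm y - norm w) * 1"
      by (intro add_strict_left_mono mult_strict_left_mono) (use s y norm_ge_zero[of y] in linarith)+
    finally show ?thesis by simp
  qed
  have kder: "(k has_field_derivative blinfun_apply (fderiv f (y + \<zeta> *\<^sub>C w)) w) (at \<zeta>)" if "\<zeta> \<in> ball 0 R" for \<zeta>
    unfolding k_def by (rule holomorphic_map_on_slice[OF f inb[OF that]])
  have k0: "(k has_field_derivative blinfun_apply (fderiv f y) w) (at 0)"
    using kder[of 0] R by (simp add: scaleC.zero_left)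
  have holk: "k holomorphic_on ball 0 R"
    using kder unfolding holomorphic_on_open[OF open_ball] by blast
  have holk': "(\<lambda>\<zeta>. \<zeta> * k \<zeta>) holomorphic_on ball 0 R" by (intro holomorphic_intros holk)
  have dk: "deriv k 0 = blinfun_apply (fderiv f y) w" using k0 by (rule DERIV_imp_deriv)
  have "((\<lambda>\<zeta>. \<zeta> * k \<zeta>) has_field_derivative f y) (at 0)"
    using k0 by (auto intro!: derivative_eq_intros simp: k_def scaleC.zero_left)
  then have dk': "deriv (\<lambda>\<zeta>. \<zeta> * k \<zeta>) 0 = f y" by (rule DERIV_imp_deriv)
  let ?c = "\<lambda>t. cis (2 * pi * t)"
  have "((\<lambda>t. ((2 * cos (2 * pi * t)) *\<^sub>R k (?c t)) *\<^sub>C y + ((2 * cos (2 * pi * t)) *\<^sub>R (?c t * k (?c t))) *\<^sub>C w)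
      has_integral (deriv k 0 *\<^sub>C y + deriv (\<lambda>\<zeta>. \<zeta> * k \<zeta>) 0 *\<^sub>C w)) {0..1}"
    using has_integral_add[OF
        has_integral_linear[OF cauchy_derivative_circle[OF holk R] scaleC.bounded_linear_left[of y]]
        has_integral_linear[OF cauchy_derivative_circle[OF holk' R] scaleC.bounded_linear_left[of w]]]
    by (simp add: o_def)
  moreover have "((2 * cos (2 * pi * t)) *\<^sub>R k (?c t)) *\<^sub>C y + ((2 * cos (2 * pi * t)) *\<^sub>R (?c t * k (?c t))) *\<^sub>C w
      = (2 * cos (2 * pi * t)) *\<^sub>R (f (y + ?c t *\<^sub>C w) *\<^sub>C (y + ?c t *\<^sub>C w))" for t
    by (simp add: scaleC.scaleR_left k_def scaleC_add_right scaleC_scaleC scaleR_add_right mult.commute)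
  ultimately have "((\<lambda>t. (2 * cos (2 * pi * t)) *\<^sub>R (f (y + ?c t *\<^sub>C w) *\<^sub>C (y + ?c t *\<^sub>C w)))
      has_integral (blinfun_apply (fderiv f y) w *\<^sub>C y + f y *\<^sub>C w)) {0..1}"
    by (simp add: dk dk')
  then have "circle_mean (\<lambda>z. f z *\<^sub>C z) y w = blinfun_apply (fderiv f y) w *\<^sub>C y + f y *\<^sub>C w"
    unfolding circle_mean_def by (rule integral_unique)
  then show "blinfun_apply (fderiv (\<lambda>z. f z *\<^sub>C z) y) w = circle_mean (\<lambda>z. f z *\<^sub>C z) y w"
    by (simp add: fderiv_eqI[OF has_derivative_scaleC_ident[OF holomorphic_map_onD(1)[OF f y]]])
qed

text \<open>
  The iterated Frechet derivatives are real-linear, so they are compared with the complex derivatives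
  of \<open>g\<close> along the real diameter only; there both are derivatives with respect to a real parameter.
\<close>

lemma higher_deriv_on_reals_step:
  fixes g :: "complex \<Rightarrow> complex"
  assumes g: "g holomorphic_on ball 0 1"
    and eq: "\<And>s. \<bar>s\<bar> < 1 \<Longrightarrow> (deriv ^^ n) g (of_real s) = \<phi> s"
    and d: "\<And>s. \<bar>s\<bar> < 1 \<Longrightarrow> (\<phi> has_vector_derivative \<phi>' s) (at s)"
    and s: "\<bar>s\<bar> < 1"
  shows "(deriv ^^ Suc n) g (of_real s) = \<phi>' s"
proof -
  have "(deriv ^^ n) g holomorphic_on ball 0 1" by (intro holomorphic_higher_deriv g) simp
  then have "((deriv ^^ n) g has_field_derivative (deriv ^^ Suc n) g (of_real s)) (at (of_real s))"
    using holomorphic_derivI[of "(deriv ^^ n) g" "ball 0 1" "of_real s"] s by simp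
  then have 1: "((\<lambda>s. (deriv ^^ n) g (of_real s)) has_vector_derivative (deriv ^^ Suc n) g (of_real s)) (at s)"
    by (rule has_vector_derivative_real_field)
  have "((\<lambda>s. (deriv ^^ n) g (of_real s)) has_vector_derivative \<phi>' s) (at s)"
    by (rule has_vector_derivative_transform_within_open[OF d[OF s], of "{-1<..<1}"]) (use s eq in auto)
  then show ?thesis using 1 vector_derivative_unique_at by blast
qed

lemma mean_differentiable_line:
  assumes G: "mean_differentiable G" and u: "norm u = 1" and s: "\<bar>s\<bar> < 1"
  shows "((\<lambda>s. G (s *\<^sub>R u)) has_vector_derivative blinfun_apply (fderiv G (s *\<^sub>R u)) u) (at s)"
proof -
  have "((\<lambda>s. s *\<^sub>R u) has_vector_derivative u) (at s)"
    by (auto intro!: derivative_eq_intros)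
  then have "((\<lambda>s. s *\<^sub>R u) has_derivative (\<lambda>x. x *\<^sub>R u)) (at s)"
    by (simp add: has_vector_derivative_def)
  moreover have "(G has_derivative blinfun_apply (fderiv G (s *\<^sub>R u))) (at (s *\<^sub>R u))"
    by (rule mean_differentiableD(1)[OF G]) (use u s in simp)
  ultimately have "((\<lambda>s. G (s *\<^sub>R u)) has_derivative (\<lambda>x. blinfun_apply (fderiv G (s *\<^sub>R u)) (x *\<^sub>R u))) (at s)"
    by (rule has_derivative_compose)
  then show ?thesis by (simp add: has_vector_derivative_def blinfun.scaleR_right)
qed

lemma A_eq_taylor_coefficients:
  fixes F :: "'a::complex_banach \<Rightarrow> 'a"
  assumes F: "mean_differentiable F" and z: "z \<noteq> 0" and l: "l \<in> support_functionals z"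
    and u: "u = (1 / norm z) *\<^sub>R z"
    and g: "g holomorphic_on ball 0 1"
    and eq: "\<And>s. \<bar>s\<bar> < 1 \<Longrightarrow> l (F (s *\<^sub>R u)) = g (of_real s)"
  shows "A2 F l z = (deriv ^^ 2) g 0 / fact 2"
    and "A3 F l z = (deriv ^^ 3) g 0 / fact 3"
    and "A4 F l z = (deriv ^^ 4) g 0 / fact 4"
proof -
  have lb: "bounded_linear l" using l by (simp add: support_functionals_def bounded_clinear_def)
  have u1: "norm u = 1" using z by (simp add: u)
  note F1 = mean_differentiable_fderiv[OF F]
  note F2 = mean_differentiable_fderiv[OF F1]
  note F3 = mean_differentiable_fderiv[OF F2]
  define d1 where "d1 s = l (fderiv F (s *\<^sub>R u) u)" for s
  define d2 where "d2 s = l (fderiv (fderiv F) (s *\<^sub>R u) u u)" for s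
  define d3 where "d3 s = l (fderiv (fderiv (fderiv F)) (s *\<^sub>R u) u u u)" for s
  define d4 where "d4 s = l (fderiv (fderiv (fderiv (fderiv F))) (s *\<^sub>R u) u u u u)" for s
  note app = bounded_linear.has_vector_derivative[OF blinfun.bounded_linear_left[of u]]
  note lapp = bounded_linear.has_vector_derivative[OF lb]
  note line = mean_differentiable_line[OF _ u1]
  have D0: "((\<lambda>s. l (F (s *\<^sub>R u))) has_vector_derivative d1 s) (at s)" if "\<bar>s\<bar> < 1" for s
    unfolding d1_def by (intro lapp line F that)
  have D1: "(d1 has_vector_derivative d2 s) (at s)" if "\<bar>s\<bar> < 1" for s
    unfolding d1_def[abs_def] d2_def by (intro lapp app line F1 that)
  have D2: "(d2 has_vector_derivative d3 s) (at s)" if "\<bar>s\<bar> < 1" for s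
    unfolding d2_def[abs_def] d3_def by (intro lapp app line F2 that)
  have D3: "(d3 has_vector_derivative d4 s) (at s)" if "\<bar>s\<bar> < 1" for s
    unfolding d3_def[abs_def] d4_def by (intro lapp app line F3 that)
  have e0: "(deriv ^^ 0) g (of_real s) = l (F (s *\<^sub>R u))" if "\<bar>s\<bar> < 1" for s using eq that by simp
  note e1 = higher_deriv_on_reals_step[OF g e0 D0]
  note e2 = higher_deriv_on_reals_step[OF g e1 D1]
  note e3 = higher_deriv_on_reals_step[OF g e2 D2]
  note e4 = higher_deriv_on_reals_step[OF g e3 D3]
  have zu: "z = norm z *\<^sub>R u" using z by (simp add: u)
  have nz: "complex_of_real (norm z) \<noteq> 0" using z by simp
  have lz: "l (r *\<^sub>R v) = of_real r * l v" for r v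
    by (simp add: linear_simps(5)[OF lb] scaleR_conv_of_real)
  have "l (fderiv (fderiv F) 0 z z) = of_real (norm z) ^ 2 * d2 0"
    unfolding d2_def by (subst (1 2) zu) (simp add: blinfun.bilinear_simps lz power2_eq_square)
  then show "A2 F l z = (deriv ^^ 2) g 0 / fact 2"
    using e2[of 0] nz by (simp add: A2_def eval_nat_numeral)
  have "l (fderiv (fderiv (fderiv F)) 0 z z z) = of_real (norm z) ^ 3 * d3 0"
    unfolding d3_def by (subst (1 2 3) zu) (simp add: blinfun.bilinear_simps lz power3_eq_cube)
  then show "A3 F l z = (deriv ^^ 3) g 0 / fact 3"
    using e3[of 0] nz by (simp add: A3_def eval_nat_numeral)
  have "l (fderiv (fderiv (fderiv (fderiv F))) 0 z z z z) = of_real (norm z) ^ 4 * d4 0"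
    unfolding d4_def by (subst (1 2 3 4) zu) (simp add: blinfun.bilinear_simps lz power4_eq_xxxx)
  then show "A4 F l z = (deriv ^^ 4) g 0 / fact 4"
    using e4[of 0] nz by (simp add: A4_def eval_nat_numeral)
qed

lemma slice_of_scaleC_ident:
  fixes f :: "'a::complex_banach \<Rightarrow> complex"
  assumes f: "holomorphic_map_on f (ball 0 1)" and f0: "f 0 = 1"
    and z: "z \<noteq> 0" and l: "l \<in> support_functionals z"
    and u: "u = (1 / norm z) *\<^sub>R z" and h: "h = (\<lambda>\<zeta>. f (\<zeta> *\<^sub>C u))"
  shows "h holomorphic_on ball 0 1" "h 0 = 1"
    and "\<zeta> \<in> ball 0 1 \<Longrightarrow> deriv h \<zeta> = blinfun_apply (fderiv f (\<zeta> *\<^sub>C u)) u"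
    and "A2 (\<lambda>z. f z *\<^sub>C z) l z = (deriv ^^ 2) (\<lambda>\<zeta>. \<zeta> * h \<zeta>) 0 / fact 2"
    and "A3 (\<lambda>z. f z *\<^sub>C z) l z = (deriv ^^ 3) (\<lambda>\<zeta>. \<zeta> * h \<zeta>) 0 / fact 3"
    and "A4 (\<lambda>z. f z *\<^sub>C z) l z = (deriv ^^ 4) (\<lambda>\<zeta>. \<zeta> * h \<zeta>) 0 / fact 4"
proof -
  have u1: "norm u = 1" using z by (simp add: u)
  have der: "(h has_field_derivative blinfun_apply (fderiv f (\<zeta> *\<^sub>C u)) u) (at \<zeta>)" if "\<zeta> \<in> ball 0 1" for \<zeta>
    using holomorphic_map_on_slice[OF f, of 0 \<zeta> u] that u1 by (simp add: h norm_scaleC)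
  then show hol: "h holomorphic_on ball 0 1" unfolding holomorphic_on_open[OF open_ball] by blast
  show "h 0 = 1" by (simp add: h f0 scaleC.zero_left)
  show "\<zeta> \<in> ball 0 1 \<Longrightarrow> deriv h \<zeta> = blinfun_apply (fderiv f (\<zeta> *\<^sub>C u)) u"
    by (rule DERIV_imp_deriv[OF der])
  have lin: "bounded_linear l" and lc: "\<And>c x. l (c *\<^sub>C x) = c * l x" and lz: "l z = of_real (norm z)"
    using l by (auto simp: support_functionals_def bounded_clinear_def scaleC_complex_def)
  have "l u = 1" using z by (simp add: u linear_simps(5)[OF lin] lz scaleR_conv_of_real)
  then have "l (f (s *\<^sub>R u) *\<^sub>C (s *\<^sub>R u)) = of_real s * h (of_real s)" for s
    by (simp add: lc h scaleC_of_real linear_simps(5)[OF lin] scaleR_conv_of_real)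
  moreover have "(\<lambda>\<zeta>. \<zeta> * h \<zeta>) holomorphic_on ball 0 1" by (intro holomorphic_intros hol)
  ultimately show "A2 (\<lambda>z. f z *\<^sub>C z) l z = (deriv ^^ 2) (\<lambda>\<zeta>. \<zeta> * h \<zeta>) 0 / fact 2"
    and "A3 (\<lambda>z. f z *\<^sub>C z) l z = (deriv ^^ 3) (\<lambda>\<zeta>. \<zeta> * h \<zeta>) 0 / fact 3"
    and "A4 (\<lambda>z. f z *\<^sub>C z) l z = (deriv ^^ 4) (\<lambda>\<zeta>. \<zeta> * h \<zeta>) 0 / fact 4"
    using A_eq_taylor_coefficients[OF mean_differentiable_scaleC_ident[OF f] z l u] by blast+
qed

section \<open>Coefficients of Schwarz functions and of starlike functions on the disc\<close>

lemma higher_deriv_bound_unit_disc: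
  assumes hol: "m holomorphic_on ball 0 1" and bd: "\<And>z. z \<in> ball 0 1 \<Longrightarrow> cmod (m z) \<le> 1"
  shows "cmod ((deriv ^^ n) m 0) \<le> fact n"
proof -
  have le: "cmod ((deriv ^^ n) m 0) \<le> fact n / r ^ n" if r: "0 < r" "r < 1" for r :: real
  proof -
    have sub: "cball 0 r \<subseteq> ball (0::complex) 1" using r by auto
    have "cmod ((deriv ^^ n) m 0) \<le> fact n * 1 / r ^ n"
    proof (rule Cauchy_inequality)
      show "m holomorphic_on ball 0 r"
        using holomorphic_on_subset[OF hol] sub ball_subset_cball by blast
      show "continuous_on (cball 0 r) m"
        using continuous_on_subset[OF holomorphic_on_imp_continuous_on[OF hol] sub] .
      show "\<And>x. cmod (0 - x) = r \<Longrightarrow> cmod (m x) \<le> 1"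
        using bd r by auto
    qed (use r in auto)
    then show ?thesis by simp
  qed
  have lim: "((\<lambda>r::real. fact n / r ^ n) \<longlongrightarrow> fact n / 1 ^ n) (at_left 1)"
    by (intro tendsto_intros) auto
  have ev: "eventually (\<lambda>r::real. cmod ((deriv ^^ n) m 0) \<le> fact n / r ^ n) (at_left 1)"
    using eventually_at_left_real[of 0 "1::real"] by (rule eventually_mono) (auto intro: le)
  show ?thesis using tendsto_lowerbound[OF lim ev] by simp
qed

text \<open>
  After composition with the disc automorphism \<open>w \<mapsto> (w - c) / (1 - cnj c * w)\<close>, \<open>c = \<psi> 0\<close>, the function
  vanishes at 0 and is still bounded by 1, so its coefficients are at most 1.  Its first
  nonconstant coefficient is that of \<open>\<psi>\<close> divided by \<open>1 - \<bar>c\<bar>^2\<close>.  If \<open>\<bar>c\<bar> = 1\<close>,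
  then \<open>\<psi>\<close> is constant by the maximum principle.
\<close>

lemma first_coefficient_bounds:
  assumes hol: "\<psi> holomorphic_on ball 0 1" and bd: "\<And>z. z \<in> ball 0 1 \<Longrightarrow> cmod (\<psi> z) \<le> 1"
  shows "cmod (deriv \<psi> 0) \<le> 1 - (cmod (\<psi> 0))\<^sup>2"
    and "deriv \<psi> 0 = 0 \<Longrightarrow> cmod ((deriv ^^ 2) \<psi> 0) / 2 \<le> 1 - (cmod (\<psi> 0))\<^sup>2"
proof -
  have "cmod (deriv \<psi> 0) \<le> 1 - (cmod (\<psi> 0))\<^sup>2 \<and>
    (deriv \<psi> 0 = 0 \<longrightarrow> cmod ((deriv ^^ 2) \<psi> 0) / 2 \<le> 1 - (cmod (\<psi> 0))\<^sup>2)"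
  proof (cases "cmod (\<psi> 0) = 1")
    case True
    have "\<psi> constant_on ball 0 1"
    proof (rule maximum_modulus_principle[OF hol])
      show "0 \<in> ball (0::complex) 1" by simp
      show "\<And>z. z \<in> ball 0 1 \<Longrightarrow> cmod (\<psi> z) \<le> cmod (\<psi> 0)"
        using bd True by simp
    qed auto
    then obtain c where c: "\<And>z. z \<in> ball 0 1 \<Longrightarrow> \<psi> z = c"
      unfolding constant_on_def by blast
    have "(deriv ^^ n) \<psi> 0 = (deriv ^^ n) (\<lambda>_. c) 0" for n
      by (rule higher_deriv_transform_within_open[OF hol, of "\<lambda>_. c"]) (auto simp: c)
    from this[of 1] this[of 2] show ?thesis
      using True by (simp add: numeral_2_eq_2)
  next
    case False
    define c where "c = \<psi> 0"
    have c1: "cmod c < 1" using bd[of 0] False by (simp add: c_def)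
    define k where "k = (\<lambda>z. 1 - cnj c * \<psi> z)"
    define m where "m = (\<lambda>z. (\<psi> z - c) / k z)"
    have knz: "k z \<noteq> 0" if "z \<in> ball 0 1" for z
    proof
      assume "k z = 0"
      then have "cmod (cnj c * \<psi> z) = 1" by (simp add: k_def)
      moreover have "cmod c * cmod (\<psi> z) \<le> cmod c * 1"
        by (rule mult_left_mono) (use bd[OF that] in auto)
      ultimately show False using c1 by (simp add: norm_mult)
    qed
    have holk: "k holomorphic_on ball 0 1" unfolding k_def by (intro holomorphic_intros hol)
    have holm: "m holomorphic_on ball 0 1"
      unfolding m_def by (intro holomorphic_intros hol holk knz) 
    have mbd: "cmod (m z) \<le> 1" if "z \<in> ball 0 1" for z
    proof -
      have "(cmod (k z))\<^sup>2 - (cmod (\<psi> z - c))\<^sup>2 = (1 - (cmod c)\<^sup>2) * (1 - (cmod (\<psi> z))\<^sup>2)"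
        unfolding k_def cmod_power2 by (simp add: power2_eq_square algebra_simps)
      moreover have "0 \<le> (1 - (cmod c)\<^sup>2) * (1 - (cmod (\<psi> z))\<^sup>2)"
        using c1 bd[OF that] by (intro mult_nonneg_nonneg) (auto simp: abs_square_le_1 power_le_one)
      ultimately have "(cmod (\<psi> z - c))\<^sup>2 \<le> (cmod (k z))\<^sup>2" by linarith
      then have "cmod (\<psi> z - c) \<le> cmod (k z)"
        by (rule power2_le_imp_le) simp
      then show ?thesis using knz[OF that] by (simp add: m_def norm_divide divide_le_eq)
    qed
    have m0: "m 0 = 0" by (simp add: m_def c_def)
    have k0: "k 0 = of_real (1 - (cmod c)\<^sup>2)"
      unfolding k_def c_def[symmetric]
      by (metis complex_norm_square mult.commute of_real_1 of_real_diff of_real_power)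
    have leib: "(deriv ^^ n) (\<lambda>z. \<psi> z - c) 0 =
        (\<Sum>i = 0..n. of_nat (n choose i) * (deriv ^^ i) m 0 * (deriv ^^ (n - i)) k 0)" for n
    proof -
      have "(deriv ^^ n) (\<lambda>z. \<psi> z - c) 0 = (deriv ^^ n) (\<lambda>z. m z * k z) 0"
      proof (rule higher_deriv_transform_within_open)
        show "(\<lambda>z. \<psi> z - c) holomorphic_on ball 0 1" by (intro holomorphic_intros hol)
        show "(\<lambda>z. m z * k z) holomorphic_on ball 0 1" by (intro holomorphic_intros holm holk)
        show "\<And>z. z \<in> ball 0 1 \<Longrightarrow> \<psi> z - c = m z * k z" using knz by (simp add: m_def)
      qed auto
      then show ?thesis using higher_deriv_mult[OF holm holk, of 0 n] by simp
    qed
    have dpsi: "(deriv ^^ n) (\<lambda>z. \<psi> z - c) 0 = (deriv ^^ n) \<psi> 0" if "n > 0" for n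
      using that higher_deriv_diff[OF hol holomorphic_on_const, where z = 0 and n = n] by simp
    have dk: "deriv k 0 = - cnj c * deriv \<psi> 0"
    proof -
      have "(\<psi> has_field_derivative deriv \<psi> 0) (at 0)"
        using holomorphic_derivI[OF hol, of 0] by simp
      then have "(k has_field_derivative - cnj c * deriv \<psi> 0) (at 0)"
        unfolding k_def by (auto intro!: derivative_eq_intros)
      then show ?thesis by (rule DERIV_imp_deriv)
    qed
    have k0': "cmod (k 0) = 1 - (cmod c)\<^sup>2"
      unfolding k0 norm_of_real using c1 by (simp add: abs_square_le_1)
    have 1: "deriv \<psi> 0 = deriv m 0 * k 0"
      using leib[of 1] dpsi[of 1] m0 by simp
    have 2: "(deriv ^^ 2) \<psi> 0 = (deriv ^^ 2) m 0 * k 0 + 2 * deriv m 0 * deriv k 0"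
      using leib[of 2] dpsi[of 2] m0 by (simp add: numeral_2_eq_2 add.commute)
    have nn: "0 \<le> 1 - (cmod c)\<^sup>2" using c1 by (simp add: abs_square_le_1)
    have "cmod (deriv m 0) \<le> 1"
      using higher_deriv_bound_unit_disc[OF holm mbd, of 1] by simp
    then have A: "cmod (deriv \<psi> 0) \<le> 1 - (cmod c)\<^sup>2"
      unfolding 1 norm_mult k0' using nn by (rule mult_left_le_one_le[rotated 1, OF norm_ge_zero])
    have "cmod ((deriv ^^ 2) m 0) / 2 \<le> 1"
      using higher_deriv_bound_unit_disc[OF holm mbd, of 2] by simp
    then have "cmod ((deriv ^^ 2) m 0) / 2 * (1 - (cmod c)\<^sup>2) \<le> 1 * (1 - (cmod c)\<^sup>2)"
      using nn by (rule mult_right_mono)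
    then have B: "deriv \<psi> 0 = 0 \<longrightarrow> cmod ((deriv ^^ 2) \<psi> 0) / 2 \<le> 1 - (cmod c)\<^sup>2"
      by (simp add: 2 dk norm_mult k0')
    show ?thesis using A B by (simp add: c_def)
  qed
  then show "cmod (deriv \<psi> 0) \<le> 1 - (cmod (\<psi> 0))\<^sup>2"
    and "deriv \<psi> 0 = 0 \<Longrightarrow> cmod ((deriv ^^ 2) \<psi> 0) / 2 \<le> 1 - (cmod (\<psi> 0))\<^sup>2" by auto
qed

text \<open>
  Replacing \<open>\<phi>\<close> by its even part changes neither \<open>\<phi> 0\<close> nor the coefficient of \<open>\<zeta>^2\<close>, keeps the bound, and
  removes the linear coefficient.
\<close>

lemma second_coefficient_bound:
  assumes hol: "\<phi> holomorphic_on ball 0 1" and bd: "\<And>z. z \<in> ball 0 1 \<Longrightarrow> cmod (\<phi> z) \<le> 1"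
  shows "cmod ((deriv ^^ 2) \<phi> 0) / 2 \<le> 1 - (cmod (\<phi> 0))\<^sup>2"
proof -
  define e where "e = (\<lambda>z. 1 / 2 * \<phi> z + 1 / 2 * \<phi> (- z))"
  have holm: "(\<lambda>z. \<phi> (-1 * z)) holomorphic_on ball 0 1"
    using holomorphic_on_compose_gen[of "\<lambda>z. -1 * z" "ball 0 1" \<phi> "ball 0 1", OF _ hol]
    by (fastforce simp: o_def intro: holomorphic_intros)
  have hole: "e holomorphic_on ball 0 1"
    unfolding e_def using holm by (intro holomorphic_intros hol) simp_all
  have de: "(deriv ^^ n) e 0 = 1 / 2 * (deriv ^^ n) \<phi> 0 + 1 / 2 * ((-1) ^ n * (deriv ^^ n) \<phi> 0)" for n
  proof -
    have c: "(deriv ^^ n) (\<lambda>z. \<phi> (-1 * z)) 0 = (-1) ^ n * (deriv ^^ n) \<phi> (-1 * 0)"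
      by (rule higher_deriv_compose_linear[OF hol, where S = "ball 0 1"]) auto
    have "(deriv ^^ n) e 0 = (deriv ^^ n) (\<lambda>z. 1 / 2 * \<phi> z) 0 + (deriv ^^ n) (\<lambda>z. 1 / 2 * \<phi> (-1 * z)) 0"
      unfolding e_def using higher_deriv_add[of "\<lambda>z. 1 / 2 * \<phi> z" "ball 0 1" "\<lambda>z. 1 / 2 * \<phi> (-1 * z)" 0 n]
      by (simp add: holomorphic_intros hol holm[simplified])
    also have "\<dots> = 1 / 2 * (deriv ^^ n) \<phi> 0 + 1 / 2 * (deriv ^^ n) (\<lambda>z. \<phi> (-1 * z)) 0"
      using higher_deriv_cmult[OF hol, of 0 n "1/2"] higher_deriv_cmult[OF holm, of 0 n "1/2"]
      by (simp only: centre_in_ball open_ball simp_thms zero_less_one)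
    finally show ?thesis unfolding c by simp
  qed
  have "cmod (e z) \<le> 1" if "z \<in> ball 0 1" for z
  proof -
    have "cmod (e z) \<le> cmod (1 / 2 * \<phi> z) + cmod (1 / 2 * \<phi> (- z))"
      unfolding e_def by (rule norm_triangle_ineq)
    also have "\<dots> \<le> 1" using bd[of z] bd[of "-z"] that by (simp add: norm_mult norm_divide)
    finally show ?thesis .
  qed
  from first_coefficient_bounds(2)[OF hole this] de[of 1] de[of 2] show ?thesis
    by (simp add: e_def)
qed

text \<open>
  Writing \<open>\<zeta> g' / g = (1 + W) / (1 - W)\<close> with \<open>g = \<zeta> h\<close> gives \<open>W = \<zeta> h' / (2 h + \<zeta> h')\<close>.  It maps the disc
  into itself and fixes 0, so \<open>\<phi> = W / \<zeta>\<close> is bounded by 1 by the Schwarz lemma.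
\<close>

lemma starlike_slice_schwarz:
  assumes hol: "h holomorphic_on ball 0 1" and h0: "h 0 = 1"
    and nz: "\<And>\<zeta>. \<zeta> \<in> ball 0 1 - {0} \<Longrightarrow> h \<zeta> \<noteq> 0"
    and sub: "\<And>\<zeta>. \<zeta> \<in> ball 0 1 - {0} \<Longrightarrow>
                (h \<zeta> + \<zeta> * deriv h \<zeta>) / h \<zeta> \<in> half_plane_map ` ball 0 1"
  obtains \<phi> where "\<phi> holomorphic_on ball 0 1" "\<And>\<zeta>. \<zeta> \<in> ball 0 1 \<Longrightarrow> cmod (\<phi> \<zeta>) \<le> 1"
    "\<And>\<zeta>. \<zeta> \<in> ball 0 1 \<Longrightarrow> deriv h \<zeta> = \<phi> \<zeta> * (2 * h \<zeta> + \<zeta> * deriv h \<zeta>)"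
proof -
  define q where "q = (\<lambda>\<zeta>. 2 * h \<zeta> + \<zeta> * deriv h \<zeta>)"
  define \<phi> where "\<phi> = (\<lambda>\<zeta>. deriv h \<zeta> / q \<zeta>)"
  define W where "W = (\<lambda>\<zeta>. \<zeta> * \<phi> \<zeta>)"
  have key: "q \<zeta> \<noteq> 0 \<and> cmod (W \<zeta>) < 1" if z: "\<zeta> \<in> ball 0 1" for \<zeta>
  proof (cases "\<zeta> = 0")
    case True
    then show ?thesis by (simp add: q_def W_def h0)
  next
    case False
    obtain w where w: "w \<in> ball 0 1" and eq: "(h \<zeta> + \<zeta> * deriv h \<zeta>) / h \<zeta> = (1 + w) / (1 - w)"
      using sub[of \<zeta>] z False by (auto simp: half_plane_map_def)
    have w1: "1 - w \<noteq> 0" using w by auto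
    have hz: "h \<zeta> \<noteq> 0" using nz z False by auto
    have e: "(h \<zeta> + \<zeta> * deriv h \<zeta>) * (1 - w) = (1 + w) * h \<zeta>"
      using eq w1 hz by (simp add: frac_eq_eq)
    have q1: "q \<zeta> * (1 - w) = 2 * h \<zeta>"
    proof -
      have "q \<zeta> * (1 - w) = (h \<zeta> + \<zeta> * deriv h \<zeta>) * (1 - w) + h \<zeta> * (1 - w)"
        by (simp add: q_def algebra_simps)
      then show ?thesis unfolding e by (simp add: algebra_simps)
    qed
    then have qn: "q \<zeta> \<noteq> 0" using hz by auto
    have "\<zeta> * deriv h \<zeta> = w * q \<zeta>"
      using e unfolding q_def by algebra
    moreover have "W \<zeta> = (\<zeta> * deriv h \<zeta>) / q \<zeta>" by (simp add: W_def \<phi>_def)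
    ultimately have "W \<zeta> = w" using qn by simp
    then show ?thesis using w qn by simp
  qed
  have hol\<phi>: "\<phi> holomorphic_on ball 0 1"
    unfolding \<phi>_def q_def
    by (intro holomorphic_intros hol) (use key in \<open>auto simp: q_def\<close>)
  have holW: "W holomorphic_on ball 0 1" unfolding W_def by (intro holomorphic_intros hol\<phi>)
  have W0: "W 0 = 0" by (simp add: W_def)
  have "(W has_field_derivative (0 * deriv \<phi> 0 + 1 * \<phi> 0)) (at 0)"
    unfolding W_def using holomorphic_derivI[OF hol\<phi>, of 0]
    by (auto intro!: derivative_eq_intros)
  then have dW: "deriv W 0 = \<phi> 0" by (simp add: DERIV_imp_deriv)
  have bd: "cmod (\<phi> \<zeta>) \<le> 1" if z: "\<zeta> \<in> ball 0 1" for \<zeta>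
  proof (cases "\<zeta> = 0")
    case True
    then show ?thesis using Schwarz_Lemma(2)[OF holW W0, of 0] key dW by simp
  next
    case False
    have "cmod (W \<zeta>) \<le> cmod \<zeta>" using Schwarz_Lemma(1)[OF holW W0, of \<zeta>] key z by simp
    then show ?thesis using False by (simp add: W_def norm_mult)
  qed
  show thesis
    by (rule that[OF hol\<phi> bd]) (use key in \<open>auto simp: \<phi>_def q_def\<close>)
qed

text \<open>
  Since \<open>2 h + \<zeta> h' = h + g'\<close> has the coefficients \<open>(n + 2) h_n\<close>, comparing coefficients in
  \<open>h' = \<phi> (h + g')\<close> is a recursion for the coefficients \<open>h_n\<close>, and \<open>g\<close> has the coefficients \<open>h_(n - 1)\<close>.
\<close>

lemma starlike_coefficients_by_schwarz:
  assumes hol: "h holomorphic_on ball 0 1" and h0: "h 0 = 1"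
    and hol\<phi>: "\<phi> holomorphic_on ball 0 1"
    and eq: "\<And>\<zeta>. \<zeta> \<in> ball 0 1 \<Longrightarrow> deriv h \<zeta> = \<phi> \<zeta> * (2 * h \<zeta> + \<zeta> * deriv h \<zeta>)"
    and g: "g = (\<lambda>\<zeta>. \<zeta> * h \<zeta>)"
    and c: "c0 = \<phi> 0" "c1 = deriv \<phi> 0" "c2 = (deriv ^^ 2) \<phi> 0 / 2"
  shows "(deriv ^^ 2) g 0 / fact 2 = 2 * c0"
    and "(deriv ^^ 3) g 0 / fact 3 = c1 + 3 * c0\<^sup>2"
    and "(deriv ^^ 4) g 0 / fact 4 = 2 / 3 * c2 + 10 / 3 * c0 * c1 + 4 * c0 ^ 3"
proof -
  have holg: "g holomorphic_on ball 0 1" unfolding g by (intro holomorphic_intros hol)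
  define q where "q = (\<lambda>\<zeta>. h \<zeta> + deriv g \<zeta>)"
  have holq: "q holomorphic_on ball 0 1" unfolding q_def by (intro holomorphic_intros hol holg) auto
  have dg: "(deriv ^^ Suc n) g 0 = of_nat (Suc n) * (deriv ^^ n) h 0" for n
  proof -
    have "(deriv ^^ Suc n) g 0 = (\<Sum>i = 0..Suc n. of_nat (Suc n choose i) *
            (deriv ^^ i) (\<lambda>\<zeta>. \<zeta>) 0 * (deriv ^^ (Suc n - i)) h 0)"
      unfolding g by (rule higher_deriv_mult[OF _ hol]) (auto intro: holomorphic_intros)
    also have "\<dots> = (\<Sum>i\<in>{1}. of_nat (Suc n choose i) *
            (deriv ^^ i) (\<lambda>\<zeta>. \<zeta>) 0 * (deriv ^^ (Suc n - i)) h 0)"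
      by (rule sum.mono_neutral_right) (auto simp: higher_deriv_ident)
    finally show ?thesis by simp
  qed
  have dq: "(deriv ^^ n) q 0 = of_nat (n + 2) * (deriv ^^ n) h 0" for n
  proof -
    have "(deriv ^^ n) q 0 = (deriv ^^ n) h 0 + (deriv ^^ n) (deriv g) 0"
      unfolding q_def by (rule higher_deriv_add[OF hol]) (auto intro!: holomorphic_intros holg)
    also have "(deriv ^^ n) (deriv g) 0 = (deriv ^^ Suc n) g 0"
      by (metis comp_def funpow_Suc_right)
    finally show ?thesis unfolding dg by (simp add: algebra_simps)
  qed
  have dh: "(deriv ^^ Suc n) h 0 =
      (\<Sum>i = 0..n. of_nat (n choose i) * (deriv ^^ i) \<phi> 0 * (of_nat (n - i + 2) * (deriv ^^ (n - i)) h 0))" for n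
  proof -
    have "(deriv ^^ Suc n) h 0 = (deriv ^^ n) (deriv h) 0" by (metis comp_def funpow_Suc_right)
    also have "\<dots> = (deriv ^^ n) (\<lambda>\<zeta>. \<phi> \<zeta> * q \<zeta>) 0"
    proof (rule higher_deriv_transform_within_open)
      show "deriv h holomorphic_on ball 0 1" by (intro holomorphic_intros hol) auto
      show "(\<lambda>\<zeta>. \<phi> \<zeta> * q \<zeta>) holomorphic_on ball 0 1" by (intro holomorphic_intros hol\<phi> holq)
      show "deriv h z = \<phi> z * q z" if z: "z \<in> ball 0 1" for z
      proof -
        have "(g has_field_derivative (z * deriv h z + 1 * h z)) (at z)"
          unfolding g using holomorphic_derivI[OF hol _ z]
          by (auto intro!: derivative_eq_intros)
        then have "deriv g z = z * deriv h z + h z" by (simp add: DERIV_imp_deriv)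
        then have "q z = 2 * h z + z * deriv h z" by (simp add: q_def)
        then show ?thesis using eq[OF z] by metis
      qed
    qed auto
    also have "\<dots> = (\<Sum>i = 0..n. of_nat (n choose i) * (deriv ^^ i) \<phi> 0 * (deriv ^^ (n - i)) q 0)"
      by (rule higher_deriv_mult[OF hol\<phi> holq]) auto
    finally show ?thesis unfolding dq .
  qed
  have h1: "deriv h 0 = 2 * c0" using dh[of 0] h0 c by simp
  have h2: "(deriv ^^ 2) h 0 = 2 * c1 + 6 * c0\<^sup>2"
    using dh[of 1] h0 h1 c by (simp add: numeral_2_eq_2 algebra_simps)
  have h3: "(deriv ^^ 3) h 0 = 4 * c2 + 20 * c0 * c1 + 24 * c0 ^ 3"
    using dh[of 2] h0 h1 h2 c
    by (simp add: eval_nat_numeral algebra_simps)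
  show "(deriv ^^ 2) g 0 / fact 2 = 2 * c0"
    using dg[of 1] h1 by (simp add: eval_nat_numeral)
  show "(deriv ^^ 3) g 0 / fact 3 = c1 + 3 * c0\<^sup>2"
    using dg[of 2] h2 by (simp add: eval_nat_numeral field_simps)
  show "(deriv ^^ 4) g 0 / fact 4 = 2 / 3 * c2 + 10 / 3 * c0 * c1 + 4 * c0 ^ 3"
    using dg[of 3] h3 by (simp add: eval_nat_numeral field_simps)
qed

text \<open>
  With \<open>t = \<bar>c0\<bar>\<close>, the two auxiliary bounds hold because
  \<open>4 - (2/3 (1 - t^2) + 10/3 t (1 - t^2) + 4 t^3) = (1 - t) (10/3 + 2/3 t^2)\<close> and, using
  \<open>\<bar>c1\<bar>^2 \<le> 1 - t^2\<close> and \<open>t \<le> 1\<close> in the terms \<open>c1^2\<close> and \<open>c0 c2\<close>, the bound for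
  \<open>\<bar>2 a3^2 - a2 a4\<bar>\<close> falls short of 10 by \<open>(1 - t^2) (20/3 + 14/3 t^2)\<close>.
\<close>

lemma determinant_bound:
  fixes c0 c1 c2 :: complex
  assumes c0: "cmod c0 \<le> 1" and c1: "cmod c1 \<le> 1 - (cmod c0)\<^sup>2" and c2: "cmod c2 \<le> 1 - (cmod c0)\<^sup>2"
    and a: "a2 = 2 * c0" "a3 = c1 + 3 * c0\<^sup>2"
      "a4 = 2 / 3 * c2 + 10 / 3 * c0 * c1 + 4 * c0 ^ 3"
  shows "cmod (a2 ^ 3 - 2 * a2 * a3 ^ 2 - a2 * a4 ^ 2 + 2 * a3 ^ 2 * a4) \<le> 84"
proof -
  define t where "t = cmod c0"
  have t: "0 \<le> t" "t \<le> 1" using c0 by (auto simp: t_def)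
  have s: "0 \<le> 1 - t\<^sup>2" "1 - t\<^sup>2 \<le> 1" using t by (auto simp: power_le_one)
  have c1': "cmod c1 \<le> 1 - t\<^sup>2" and c2': "cmod c2 \<le> 1 - t\<^sup>2" using c1 c2 by (auto simp: t_def)
  have c11: "(cmod c1)\<^sup>2 \<le> 1 - t\<^sup>2"
  proof -
    have "(cmod c1)\<^sup>2 \<le> (1 - t\<^sup>2)\<^sup>2" using c1' by (rule power_mono) simp
    also have "\<dots> \<le> (1 - t\<^sup>2) * 1" unfolding power2_eq_square[of "1 - t\<^sup>2"]
      using s by (intro mult_left_mono) auto
    finally show ?thesis by simp
  qed
  have fac: "a2 ^ 3 - 2 * a2 * a3 ^ 2 - a2 * a4 ^ 2 + 2 * a3 ^ 2 * a4
      = (a2 - a4) * (a2\<^sup>2 - (2 * a3\<^sup>2 - a2 * a4))"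
    by (simp add: algebra_simps power2_eq_square power3_eq_cube)
  have A2: "cmod a2 \<le> 2" using t by (simp add: a norm_mult t_def)
  have A4: "cmod a4 \<le> 4"
  proof -
    have "cmod a4 \<le> cmod (2 / 3 * c2) + cmod (10 / 3 * c0 * c1) + cmod (4 * c0 ^ 3)"
      unfolding a by (intro norm_triangle_mono norm_triangle_ineq order_refl)
    also have "\<dots> = 2 / 3 * cmod c2 + 10 / 3 * t * cmod c1 + 4 * t ^ 3"
      by (simp add: norm_mult norm_power norm_divide t_def)
    also have "\<dots> \<le> 2 / 3 * (1 - t\<^sup>2) + 10 / 3 * t * (1 - t\<^sup>2) + 4 * t ^ 3"
      using c1' c2' t by (intro add_mono mult_left_mono) auto
    also have "\<dots> = 4 - (1 - t) * (10 / 3 + 2 / 3 * t\<^sup>2)"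
      by (simp add: field_simps power2_eq_square power3_eq_cube)
    also have "\<dots> \<le> 4" using t by simp
    finally show ?thesis .
  qed
  have H: "cmod (2 * a3\<^sup>2 - a2 * a4) \<le> 10"
  proof -
    have "2 * a3\<^sup>2 - a2 * a4 = 2 * c1\<^sup>2 + 16 / 3 * c0\<^sup>2 * c1 + 10 * c0 ^ 4 - 4 / 3 * c0 * c2"
      unfolding a by (simp add: field_simps power2_eq_square power3_eq_cube power4_eq_xxxx)
    also have "cmod \<dots> \<le> cmod (2 * c1\<^sup>2) + cmod (16 / 3 * c0\<^sup>2 * c1) + cmod (10 * c0 ^ 4) + cmod (4 / 3 * c0 * c2)"
      by (meson norm_triangle_ineq norm_triangle_ineq4 norm_triangle_mono order_refl order_trans add_mono)
    also have "\<dots> = 2 * (cmod c1)\<^sup>2 + 16 / 3 * t\<^sup>2 * cmod c1 + 10 * t ^ 4 + 4 / 3 * t * cmod c2"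
      by (simp add: norm_mult norm_power norm_divide t_def)
    also have "\<dots> \<le> 2 * (1 - t\<^sup>2) + 16 / 3 * t\<^sup>2 * (1 - t\<^sup>2) + 10 * t ^ 4 + 4 / 3 * 1 * (1 - t\<^sup>2)"
      using c1' c2' t s c11 by (intro add_mono mult_left_mono mult_mono) auto
    also have "\<dots> = 10 - (1 - t\<^sup>2) * (20 / 3 + 14 / 3 * t\<^sup>2)"
      by (simp add: field_simps power2_eq_square power4_eq_xxxx)
    also have "\<dots> \<le> 10" using s by simp
    finally show ?thesis .
  qed
  have "cmod (a2 - a4) \<le> 6" using norm_triangle_ineq4[of a2 a4] A2 A4 by linarith
  moreover have "cmod (a2\<^sup>2) \<le> 4"
    using power_mono[OF A2 norm_ge_zero, of 2] by (simp add: norm_power)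
  then have "cmod (a2\<^sup>2 - (2 * a3\<^sup>2 - a2 * a4)) \<le> 14"
    using norm_triangle_ineq4[of "a2\<^sup>2" "2 * a3\<^sup>2 - a2 * a4"] H by linarith
  ultimately have "cmod (a2 - a4) * cmod (a2\<^sup>2 - (2 * a3\<^sup>2 - a2 * a4)) \<le> 6 * 14"
    by (intro mult_mono) auto
  then show ?thesis by (simp add: fac norm_mult)
qed

section \<open>Norm-attaining functionals\<close>

definition sublinear :: "('a::real_vector \<Rightarrow> real) \<Rightarrow> bool"
  where "sublinear p \<longleftrightarrow> (\<forall>x y. p (x + y) \<le> p x + p y) \<and> (\<forall>c x. 0 \<le> c \<longrightarrow> p (c *\<^sub>R x) = c * p x)"

lemma sublinearD:
  assumes "sublinear p"
  shows "p (x + y) \<le> p x + p y" "0 \<le> c \<Longrightarrow> p (c *\<^sub>R x) = c * p x" "p 0 = 0" "- p (- x) \<le> p x"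
proof -
  show 1: "p (x + y) \<le> p x + p y" for x y using assms by (auto simp: sublinear_def)
  show 2: "0 \<le> c \<Longrightarrow> p (c *\<^sub>R x) = c * p x" for c x using assms by (auto simp: sublinear_def)
  show 3: "p 0 = 0" using 2[of 0 0] by simp
  show "- p (- x) \<le> p x" using 1[of x "- x"] 3 by simp
qed

text \<open>
  A sublinear \<open>q \<le> p\<close> with \<open>q (- u) \<le> - p u\<close> satisfies \<open>q y \<le> p (y + t u) - t p u\<close> for all \<open>t \<ge> 0\<close>;
  the infimum of these bounds is itself such a functional.  It is used in two ways:
  on the norm, to force the value at \<open>u\<close>, and on a minimal sublinear functional, to show that it is odd.
\<close>

lemma sublinear_lower:
  assumes p: "sublinear p"
  obtains q where "sublinear q" "q \<le> p" "q (- u) \<le> - p u"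
proof -
  define S where "S y = (\<lambda>t. p (y + t *\<^sub>R u) - t * p u) ` {0..}" for y
  define q where "q y = Inf (S y)" for y
  have ne: "S y \<noteq> {}" for y by (auto simp: S_def)
  have lb: "- p (- y) \<le> s" if s: "s \<in> S y" for s y
  proof -
    obtain t where t: "0 \<le> t" "s = p (y + t *\<^sub>R u) - t * p u" using s by (auto simp: S_def)
    have "p (t *\<^sub>R u) \<le> p (y + t *\<^sub>R u) + p (- y)"
      using sublinearD(1)[OF p, of "y + t *\<^sub>R u" "- y"] by simp
    then show ?thesis using t sublinearD(2)[OF p, of t u] by simp
  qed
  then have bb: "bdd_below (S y)" for y by (meson bdd_below.I)
  have le: "q y \<le> p (y + t *\<^sub>R u) - t * p u" if "0 \<le> t" for y t
    unfolding q_def by (rule cInf_lower[OF _ bb]) (use that in \<open>auto simp: S_def\<close>)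
  have ge: "b \<le> q y" if "\<And>t. 0 \<le> t \<Longrightarrow> b \<le> p (y + t *\<^sub>R u) - t * p u" for y b
    unfolding q_def by (rule cInf_greatest[OF ne]) (use that in \<open>auto simp: S_def\<close>)
  have sub: "q (x + y) \<le> q x + q y" for x y
  proof -
    have "q (x + y) - (p (y + t *\<^sub>R u) - t * p u) \<le> q x" if t: "0 \<le> t" for t
    proof (rule ge)
      fix s :: real assume s: "0 \<le> s"
      have "q (x + y) \<le> p (x + y + (s + t) *\<^sub>R u) - (s + t) * p u" by (rule le) (use s t in auto)
      also have "x + y + (s + t) *\<^sub>R u = (x + s *\<^sub>R u) + (y + t *\<^sub>R u)" by (simp add: algebra_simps)
      also have "p \<dots> \<le> p (x + s *\<^sub>R u) + p (y + t *\<^sub>R u)" by (rule sublinearD(1)[OF p])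
      finally show "q (x + y) - (p (y + t *\<^sub>R u) - t * p u) \<le> p (x + s *\<^sub>R u) - s * p u"
        by (simp add: algebra_simps)
    qed
    then have "q (x + y) - q x \<le> q y" by (intro ge) (simp add: algebra_simps)
    then show ?thesis by simp
  qed
  have scale: "c * q x \<le> q (c *\<^sub>R x)" if c: "0 < c" for c x
  proof (rule ge)
    fix t :: real assume t: "0 \<le> t"
    have "c * q x \<le> c * (p (x + (t / c) *\<^sub>R u) - (t / c) * p u)"
      using c t by (intro mult_left_mono le) auto
    also have "\<dots> = p (c *\<^sub>R (x + (t / c) *\<^sub>R u)) - t * p u"
      using c by (simp add: sublinearD(2)[OF p] right_diff_distrib)
    finally show "c * q x \<le> p (c *\<^sub>R x + t *\<^sub>R u) - t * p u"
      using c by (simp add: scaleR_add_right)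
  qed
  have hom: "q (c *\<^sub>R x) = c * q x" if "0 \<le> c" for c x
  proof (cases "c = 0")
    case True
    have "q 0 \<le> 0" using le[of 0 0] sublinearD(3)[OF p] by simp
    moreover have "0 \<le> q 0" by (rule ge) (simp add: sublinearD(2)[OF p])
    ultimately show ?thesis using True by simp
  next
    case False
    then have c: "0 < c" using that by simp
    have "inverse c * q (c *\<^sub>R x) \<le> q (inverse c *\<^sub>R c *\<^sub>R x)" by (rule scale) (use c in simp)
    then have "q (c *\<^sub>R x) \<le> c * q x" using c by (simp add: field_simps)
    then show ?thesis using scale[OF c, of x] by simp
  qed
  show thesis
  proof
    show "sublinear q" using sub hom by (simp add: sublinear_def)
    show "q \<le> p" unfolding le_fun_def using le[of 0] by simp
    show "q (- u) \<le> - p u" using le[of 1 "- u"] sublinearD(3)[OF p] by simp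
  qed
qed

text \<open>
  Zorn's lemma for the pointwise order.  Along a chain the infimum is finite because
  \<open>- p (- x) \<le> q x\<close> for every sublinear \<open>q \<le> p\<close>.
\<close>

lemma minimal_sublinear:
  assumes p: "sublinear (p :: 'a::real_vector \<Rightarrow> real)"
  obtains q where "sublinear q" "q \<le> p" "\<And>q'. sublinear q' \<Longrightarrow> q' \<le> q \<Longrightarrow> q' = q"
proof -
  define A where "A = {q :: 'a \<Rightarrow> real. sublinear q \<and> q \<le> p}"
  have "\<exists>m\<in>A. \<forall>a\<in>A. a \<le> m \<longrightarrow> a = m"
  proof (rule predicate_Zorn[where P = "\<lambda>a b. b \<le> a"])
    show "partial_order_on A (relation_of (\<lambda>a b. b \<le> a) A)"
      by (rule partial_order_on_relation_ofI) auto
    fix C assume C: "C \<in> Chains (relation_of (\<lambda>a b. b \<le> a) A)"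
    show "\<exists>u\<in>A. \<forall>a\<in>C. u \<le> a"
    proof (cases "C = {}")
      case True
      then show ?thesis using p by (auto simp: A_def)
    next
      case False
      have CA: "C \<subseteq> A" and tot: "\<And>a b. a \<in> C \<Longrightarrow> b \<in> C \<Longrightarrow> a \<le> b \<or> b \<le> a"
        using C by (auto simp: Chains_def relation_of_def)
      define m where "m x = (INF q\<in>C. q x)" for x
      have bb: "bdd_below ((\<lambda>q. q x) ` C)" for x
      proof (rule bdd_belowI2)
        fix q assume "q \<in> C"
        then have q: "sublinear q" "q \<le> p" using CA by (auto simp: A_def)
        show "- p (- x) \<le> q x"
          using sublinearD(4)[OF q(1), of x] le_funD[OF q(2), of "- x"] by simp
      qed
      have le: "m x \<le> q x" if "q \<in> C" for q x
        unfolding m_def by (rule cINF_lower[OF bb that])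
      have ge: "b \<le> m x" if "\<And>q. q \<in> C \<Longrightarrow> b \<le> q x" for b x
        unfolding m_def by (rule cINF_greatest[OF False that])
      have subC: "sublinear q" if "q \<in> C" for q using that CA by (auto simp: A_def)
      have sub: "m (x + y) \<le> m x + m y" for x y
      proof -
        have "m (x + y) - b y \<le> m x" if b: "b \<in> C" for b
        proof (rule ge)
          fix a assume a: "a \<in> C"
          \<comment> \<open>the smaller of two members of the chain bounds both terms at once\<close>
          obtain d where d: "d \<in> C" "d \<le> a" "d \<le> b" using tot[OF a b] a b by auto
          have "m (x + y) \<le> d (x + y)" by (rule le[OF d(1)])
          also have "\<dots> \<le> d x + d y" by (rule sublinearD(1)[OF subC[OF d(1)]])
          also have "\<dots> \<le> a x + b y" using d by (intro add_mono) (auto dest: le_funD)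
          finally show "m (x + y) - b y \<le> a x" by simp
        qed
        then have "m (x + y) - m x \<le> m y" by (intro ge) (simp add: algebra_simps)
        then show ?thesis by simp
      qed
      have hom: "m (c *\<^sub>R x) = c * m x" if c: "0 \<le> c" for c x
      proof (cases "c = 0")
        case True
        have "m 0 = (INF q\<in>C. 0)"
          unfolding m_def by (rule arg_cong[where f = Inf], rule image_cong) (auto simp: sublinearD(3)[OF subC])
        then have "m 0 = 0" using False by simp
        then show ?thesis using True by simp
      next
        case c0: False
        have "m (c *\<^sub>R x) / c \<le> m x"
        proof (rule ge)
          fix q assume q: "q \<in> C"
          show "m (c *\<^sub>R x) / c \<le> q x"
            using le[OF q, of "c *\<^sub>R x"] sublinearD(2)[OF subC[OF q] c, of x] c c0
            by (simp add: field_simps)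
        qed
        moreover have "c * m x \<le> m (c *\<^sub>R x)"
        proof (rule ge)
          fix q assume q: "q \<in> C"
          show "c * m x \<le> q (c *\<^sub>R x)"
            using mult_left_mono[OF le[OF q, of x] c] sublinearD(2)[OF subC[OF q] c, of x] by simp
        qed
        ultimately show ?thesis using c c0 by (simp add: field_simps)
      qed
      obtain q0 where q0: "q0 \<in> C" using False by auto
      have "q0 \<le> p" using q0 CA by (auto simp: A_def)
      then have "m x \<le> p x" for x using le[OF q0, of x] le_funD[of q0 p x] by linarith
      then have "m \<le> p" by (simp add: le_fun_def)
      then have "m \<in> A" using sub hom by (auto simp: A_def sublinear_def)
      then show ?thesis using le by (auto simp: le_fun_def)
    qed
  qed
  then obtain m where m: "m \<in> A" "\<And>a. a \<in> A \<Longrightarrow> a \<le> m \<Longrightarrow> a = m" by blast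
  show thesis
    by (rule that[of m]) (use m in \<open>auto simp: A_def\<close>)
qed

text \<open>
  The Hahn-Banach theorem for the norm.  A minimal sublinear functional \<open>q\<close> is linear, since lowering it at
  \<open>- x\<close> leaves it unchanged, which makes it odd and then additive.  Taking it below the functional
  that \<open>sublinear_lower\<close> produces from the norm forces \<open>q (- u) \<le> - \<parallel>u\<parallel>\<close>, hence \<open>q u = \<parallel>u\<parallel>\<close>.
\<close>

lemma norm_attaining_real_functional:
  fixes u :: "'a::real_normed_vector"
  obtains \<psi> :: "'a \<Rightarrow> real" where "linear \<psi>" "\<And>x. \<psi> x \<le> norm x" "\<psi> u = norm u"
proof -
  have "sublinear (norm :: 'a \<Rightarrow> real)" by (simp add: sublinear_def norm_triangle_ineq)
  then obtain p where p: "sublinear p" "p \<le> (norm :: 'a \<Rightarrow> real)" "p (- u) \<le> - norm u"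
    by (rule sublinear_lower[where u = u])
  obtain q where q: "sublinear q" "q \<le> p" and min: "\<And>q'. sublinear q' \<Longrightarrow> q' \<le> q \<Longrightarrow> q' = q"
    using minimal_sublinear[OF p(1)] by blast
  have neg: "q (- x) = - q x" for x
  proof -
    obtain r where r: "sublinear r" "r \<le> q" "r (- x) \<le> - q x"
      by (rule sublinear_lower[OF q(1), of x])
    then have "q (- x) \<le> - q x" using min[OF r(1,2)] by simp
    then show ?thesis using sublinearD(4)[OF q(1), of x] by simp
  qed
  have add: "q (x + y) = q x + q y" for x y
    using sublinearD(1)[OF q(1), of x y] sublinearD(1)[OF q(1), of "- x" "- y"]
      neg[of x] neg[of y] neg[of "x + y"] by simp
  have scl: "q (c *\<^sub>R x) = c * q x" for c x
  proof (cases "0 \<le> c")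
    case True
    then show ?thesis by (rule sublinearD(2)[OF q(1)])
  next
    case False
    then have "q ((- c) *\<^sub>R x) = (- c) * q x" by (intro sublinearD(2)[OF q(1)]) auto
    then show ?thesis by (simp add: neg)
  qed
  have le: "q x \<le> norm x" for x using q(2) p(2) by (meson le_funD order_trans)
  have "q (- u) \<le> - norm u" using le_funD[OF q(2), of "- u"] p(3) by linarith
  then have "q u = norm u" using neg[of u] le[of u] by simp
  then show thesis
    using that[of q] le by (simp add: linearI add scl)
qed

text \<open>
  The complexification \<open>l x = \<psi> x - \<i> \<psi> (\<i> x)\<close> is bounded by the norm, because rotating \<open>x\<close> makes \<open>l x\<close> a
  nonnegative real number, equal to a value of \<open>\<psi>\<close>.  Then \<open>Re (l u) = \<parallel>u\<parallel>\<close> and \<open>\<bar>l u\<bar> \<le> \<parallel>u\<parallel>\<close> leave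
  no room for an imaginary part.
\<close>

lemma support_functionals_nonempty:
  fixes u :: "'a::complex_normed_vector"
  assumes u: "u \<noteq> 0"
  shows "support_functionals u \<noteq> {}"
proof -
  obtain \<psi> :: "'a \<Rightarrow> real" where lin: "linear \<psi>" and le: "\<And>x. \<psi> x \<le> norm x" and pu: "\<psi> u = norm u"
    using norm_attaining_real_functional[of u] by blast
  define l where "l x = Complex (\<psi> x) (- \<psi> (\<i> *\<^sub>C x))" for x
  have scR: "c *\<^sub>C (r *\<^sub>R x) = r *\<^sub>R (c *\<^sub>C x)" for c r and x :: 'a
    by (simp flip: scaleC_of_real add: scaleC_scaleC mult.commute)
  have add: "l (x + y) = l x + l y" for x y
    by (simp add: l_def scaleC_add_right linear_add[OF lin] complex_eq_iff)
  have scr: "l (r *\<^sub>R x) = r *\<^sub>R l x" for r x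
    by (simp add: l_def scR linear_cmul[OF lin] complex_eq_iff)
  have ii: "l (\<i> *\<^sub>C x) = \<i> * l x" for x
  proof -
    have "\<i> *\<^sub>C \<i> *\<^sub>C x = - x"
      using scaleC_of_real[of "-1" x] by (simp add: scaleC_scaleC)
    then show ?thesis by (simp add: l_def linear_neg[OF lin] complex_eq_iff)
  qed
  have scc: "l (c *\<^sub>C x) = c * l x" for c x
  proof -
    have c: "c = of_real (Re c) + of_real (Im c) * \<i>" by (simp add: complex_eq_iff)
    have "c *\<^sub>C x = Re c *\<^sub>R x + Im c *\<^sub>R (\<i> *\<^sub>C x)"
      by (subst c) (simp only: scaleC_add_left scaleC_of_real flip: scaleC_scaleC)
    then have "l (c *\<^sub>C x) = of_real (Re c) * l x + of_real (Im c) * (\<i> * l x)"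
      by (simp add: add scr ii scaleR_conv_of_real)
    also have "\<dots> = (of_real (Re c) + of_real (Im c) * \<i>) * l x" by (simp add: algebra_simps)
    finally show ?thesis using c by simp
  qed
  have bd: "cmod (l x) \<le> norm x" for x
  proof (cases "l x = 0")
    case False
    define c where "c = cnj (sgn (l x))"
    have "c * l x = of_real (cmod (l x))"
      unfolding c_def sgn_eq using False
      by (simp add: complex_norm_square[symmetric] power2_eq_square mult.commute[of "cnj _"])
    then have "of_real (cmod (l x)) = l (c *\<^sub>C x)" by (simp add: scc)
    then have "cmod (l x) = Re (l (c *\<^sub>C x))" by (metis Re_complex_of_real)
    also have "\<dots> \<le> norm (c *\<^sub>C x)" using le by (simp add: l_def)
    also have "\<dots> = norm x" using False by (simp add: norm_scaleC c_def norm_sgn)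
    finally show ?thesis .
  qed simp
  have "Re (l u) = norm u" by (simp add: l_def pu)
  moreover from this have "Im (l u) = 0"
    using bd[of u] cmod_power2[of "l u"] power_mono[OF bd[of u], of 2] by simp
  ultimately have lu: "l u = of_real (norm u)" by (simp add: complex_eq_iff)
  have bl: "bounded_linear l"
    by (rule bounded_linear_intro[where K = 1]) (use add scr bd in auto)
  have "onorm l = 1"
  proof (rule antisym)
    show "onorm l \<le> 1" by (rule onorm_bound) (use bd in auto)
    show "1 \<le> onorm l" using le_onorm[OF bl, of u] lu u by simp
  qed
  then have "l \<in> support_functionals u"
    using bl lu by (simp add: support_functionals_def bounded_clinear_def scc scaleC_complex_def)
  then show ?thesis by auto
qed

section \<open>The upper bound\<close>

text \<open>
  The derivative of \<open>f z *\<^sub>C z\<close> preserves the line through \<open>z\<close> and acts there as multiplication by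
  \<open>q = f z + Df(z) z\<close>, which injectivity makes nonzero.  So the inverse maps \<open>f z *\<^sub>C z\<close> to
  \<open>(f z / q) *\<^sub>C z\<close>, and only the value of the functional at \<open>z\<close> enters.
\<close>

lemma starlike_quotient:
  fixes f :: "'a::complex_banach \<Rightarrow> complex"
  assumes f: "holomorphic_map_on f (ball 0 1)" and z: "norm z < 1" "z \<noteq> 0"
    and l: "l \<in> support_functionals z"
    and bij: "bij (blinfun_apply (fderiv (\<lambda>z. f z *\<^sub>C z) z))"
  shows "complex_of_real (norm z) / l (inv (blinfun_apply (fderiv (\<lambda>z. f z *\<^sub>C z) z)) (f z *\<^sub>C z))
    = (f z + blinfun_apply (fderiv f z) z) / f z"
proof -
  define L where "L = blinfun_apply (fderiv f z)"
  have L: "bounded_clinear L" "(f has_derivative L) (at z)"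
    unfolding L_def using holomorphic_map_onD[OF f] z by auto
  note fL = fderiv_eqI[OF L(2)]
  define D where "D = blinfun_apply (fderiv (\<lambda>z. f z *\<^sub>C z) z)"
  have D: "D w = f z *\<^sub>C w + L w *\<^sub>C z" for w
    unfolding D_def fderiv_eqI[OF has_derivative_scaleC_ident[OF L(2)]] ..
  have Lc: "L (c *\<^sub>C w) = c * L w" for c w
    using L(1) by (simp add: bounded_clinear_def scaleC_complex_def)
  have inj: "inj D" using bij D_def bij_is_inj by auto
  let ?q = "f z + L z"
  have Dz: "D (c *\<^sub>C z) = (c * ?q) *\<^sub>C z" for c
    by (simp add: D Lc scaleC_scaleC algebra_simps flip: scaleC_add_left)
  have "?q \<noteq> 0"
  proof
    assume "?q = 0"
    then have "D (1 *\<^sub>C z) = D (0 *\<^sub>C z)" unfolding Dz by simp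
    then have "1 *\<^sub>C z = 0 *\<^sub>C z" by (rule injD[OF inj])
    then show False using z by (simp add: scaleC_one scaleC.zero_left)
  qed
  then have "D ((f z / ?q) *\<^sub>C z) = f z *\<^sub>C z" unfolding Dz by simp
  then have "inv D (f z *\<^sub>C z) = (f z / ?q) *\<^sub>C z" by (metis inv_f_f[OF inj])
  then have "l (inv D (f z *\<^sub>C z)) = f z / ?q * of_real (norm z)"
    using l by (simp add: support_functionals_def bounded_clinear_def scaleC_complex_def)
  then show ?thesis using z by (simp add: D_def[symmetric] fL)
qed

lemma starlike_determinant_bound:
  fixes f :: "'a::complex_banach \<Rightarrow> complex"
  assumes f: "holomorphic_map_on f (ball 0 1)" and f0: "f 0 = 1"
    and F: "F = (\<lambda>z. f z *\<^sub>C z)" "F \<in> starlike_maps"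
    and z: "z \<noteq> 0" and l: "l \<in> support_functionals z"
  shows "cmod (A2 F l z ^ 3 - 2 * A2 F l z * A3 F l z ^ 2
                     - A2 F l z * A4 F l z ^ 2 + 2 * A3 F l z ^ 2 * A4 F l z) \<le> 84"
proof -
  define u where "u = (1 / norm z) *\<^sub>R z"
  have u1: "norm u = 1" using z by (simp add: u_def)
  define h where "h = (\<lambda>\<zeta>. f (\<zeta> *\<^sub>C u))"
  note slice = slice_of_scaleC_ident[OF f f0 z l u_def h_def]
  have key: "h \<zeta> \<noteq> 0 \<and> (h \<zeta> + \<zeta> * deriv h \<zeta>) / h \<zeta> \<in> half_plane_map ` ball 0 1"
    if \<zeta>: "\<zeta> \<in> ball 0 1 - {0}" for \<zeta>
  proof -
    define p where "p = \<zeta> *\<^sub>C u"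
    have "norm p = cmod \<zeta>" by (simp add: p_def norm_scaleC u1)
    then have p: "norm p < 1" "p \<noteq> 0" using \<zeta> by auto
    obtain m where m: "m \<in> support_functionals p" using support_functionals_nonempty[OF p(2)] by blast
    have "complex_of_real (norm p) / m (inv (blinfun_apply (fderiv F p)) (F p)) \<in> half_plane_map ` ball 0 1"
      using F(2) p m by (auto simp: starlike_maps_def)
    moreover have "bij (blinfun_apply (fderiv F p))"
      using F(2) p by (auto simp: starlike_maps_def locally_biholomorphic_def)
    ultimately have in1: "(f p + blinfun_apply (fderiv f p) p) / f p \<in> half_plane_map ` ball 0 1"
      using starlike_quotient[OF f p m] by (simp add: F(1))
    (* a zero of f would make the quotient 0, because division by zero yields 0 *)
    have "0 \<notin> half_plane_map ` ball 0 1"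
    proof
      assume "0 \<in> half_plane_map ` ball 0 1"
      then obtain w where "cmod w < 1" "(1 + w) / (1 - w) = 0" by (auto simp: half_plane_map_def)
      then have "w = -1 \<or> w = 1" by (auto simp: add_eq_0_iff)
      then show False using \<open>cmod w < 1\<close> by auto
    qed
    then have "f p \<noteq> 0" using in1 by auto
    moreover have "blinfun_apply (fderiv f p) p = \<zeta> * deriv h \<zeta>"
    proof -
      have "bounded_clinear (blinfun_apply (fderiv f p))" by (rule holomorphic_map_onD(2)[OF f p(1)])
      then show ?thesis
        using slice(3)[of \<zeta>] \<zeta>
        by (simp add: p_def bounded_clinear_def scaleC_complex_def)
    qed
    ultimately show ?thesis using in1 by (simp add: h_def p_def)
  qed
  obtain \<phi> where \<phi>: "\<phi> holomorphic_on ball 0 1" "\<And>\<zeta>. \<zeta> \<in> ball 0 1 \<Longrightarrow> cmod (\<phi> \<zeta>) \<le> 1"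
    and eq: "\<And>\<zeta>. \<zeta> \<in> ball 0 1 \<Longrightarrow> deriv h \<zeta> = \<phi> \<zeta> * (2 * h \<zeta> + \<zeta> * deriv h \<zeta>)"
    using starlike_slice_schwarz[OF slice(1,2)] key by metis
  note co = starlike_coefficients_by_schwarz[OF slice(1,2) \<phi>(1) eq refl refl refl refl]
  show ?thesis
  proof (rule determinant_bound)
    show "cmod (\<phi> 0) \<le> 1" using \<phi>(2)[of 0] by simp
    show "cmod (deriv \<phi> 0) \<le> 1 - (cmod (\<phi> 0))\<^sup>2" by (rule first_coefficient_bounds(1)[OF \<phi>])
    show "cmod ((deriv ^^ 2) \<phi> 0 / 2) \<le> 1 - (cmod (\<phi> 0))\<^sup>2"
      using second_coefficient_bound[OF \<phi>] by (simp add: norm_divide)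
  qed (simp_all only: F(1) slice co)
qed

section \<open>An extremal map\<close>

text \<open>
  The Sherman-Morrison formula: applying \<open>l\<close> to \<open>a w + b (l w) z = y\<close> determines
  \<open>l w = l y / (a + b l z)\<close>, and then \<open>w\<close>.
\<close>

lemma rank_one_perturbation_inverse:
  fixes z :: "'a::complex_normed_vector"
  assumes l: "bounded_clinear l" and a: "a \<noteq> 0" and b: "a + b * l z \<noteq> 0"
    and D: "D = (\<lambda>w. a *\<^sub>C w + (b * l w) *\<^sub>C z)"
  shows "bij D" "bounded_linear (inv D)"
proof -
  define E where "E = (\<lambda>y. (1 / a) *\<^sub>C y - (b / (a * (a + b * l z)) * l y) *\<^sub>C z)"
  have lc: "\<And>c x. l (c *\<^sub>C x) = c * l x" and lb: "bounded_linear l"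
    using l by (auto simp: bounded_clinear_def scaleC_complex_def)
  note ls = lc linear_simps(1,2)[OF lb]
  have DE: "D (E y) = y" for y
  proof -
    have "D (E y) = (a * (1 / a)) *\<^sub>C y + (b * (l y / a - b / (a * (a + b * l z)) * l y * l z)
        - a * (b / (a * (a + b * l z)) * l y)) *\<^sub>C z"
      by (simp add: D E_def ls scaleC.bilinear_simps scaleC_scaleC algebra_simps)
    also have "b * (l y / a - b / (a * (a + b * l z)) * l y * l z) - a * (b / (a * (a + b * l z)) * l y) = 0"
      using a b by (simp add: divide_simps) (simp add: algebra_simps)
    finally show ?thesis using a by (simp add: scaleC_one scaleC.zero_left)
  qed
  have ED: "E (D w) = w" for w
  proof -
    have "E (D w) = ((1 / a) * a) *\<^sub>C w + ((1 / a) * (b * l w)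
        - b / (a * (a + b * l z)) * (a * l w + b * l w * l z)) *\<^sub>C z"
      by (simp add: D E_def ls scaleC.bilinear_simps scaleC_scaleC algebra_simps)
    also have "(1 / a) * (b * l w) - b / (a * (a + b * l z)) * (a * l w + b * l w * l z) = 0"
      using a b by (simp add: divide_simps) (simp add: algebra_simps)
    finally show ?thesis using a by (simp add: scaleC_one scaleC.zero_left)
  qed
  show bij: "bij D" by (rule bijI') (metis ED, metis DE)
  have "inv D = E" by (metis inv_equality DE ED)
  moreover have "bounded_linear E"
    unfolding E_def
    by (intro bounded_linear_sub scaleC.bounded_linear_right
        bounded_linear_compose[OF scaleC.bounded_linear_left] bounded_linear_compose[OF bounded_linear_mult_right] lb)
  ultimately show "bounded_linear (inv D)" by simp
qed

text \<open>
  Here \<open>(f z + Df(z) z) / f z = (1 + \<i> l z) / (1 - \<i> l z)\<close>, so the starlikeness quotient at \<open>z\<close> is the value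
  of the half-plane map at \<open>\<i> l z\<close>, a point of the unit disc.
\<close>

lemma extremal_starlike_map:
  fixes l :: "'a::complex_banach \<Rightarrow> complex"
  assumes l: "bounded_clinear l" and bd: "\<And>x. cmod (l x) \<le> norm x"
    and f: "f = (\<lambda>z. 1 / (1 - \<i> * l z)\<^sup>2)"
  shows "holomorphic_map_on f (ball 0 1)" "(\<lambda>z. f z *\<^sub>C z) \<in> starlike_maps"
    and "z \<in> ball 0 1 \<Longrightarrow> blinfun_apply (fderiv f z) w = 2 * \<i> * l w / (1 - \<i> * l z) ^ 3"
proof -
  have lb: "bounded_linear l" and lc: "\<And>c x. l (c *\<^sub>C x) = c * l x"
    using l by (auto simp: bounded_clinear_def scaleC_complex_def)
  have il: "cmod (\<i> * l z) < 1" if "z \<in> ball 0 1" for z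
    using bd[of z] that by (simp add: norm_mult)
  have nz: "1 - \<i> * l z \<noteq> 0" "1 + \<i> * l z \<noteq> 0" if "z \<in> ball 0 1" for z
    using il[OF that] by (auto simp: add_eq_0_iff dest: arg_cong[where f = cmod])
  define b where "b z = 2 * \<i> / (1 - \<i> * l z) ^ 3" for z
  have der: "(f has_derivative (\<lambda>w. b z * l w)) (at z)" if z: "z \<in> ball 0 1" for z
  proof -
    have "((\<lambda>q. 1 / q\<^sup>2) has_field_derivative - 2 / q ^ 3) (at q)" if "q \<noteq> 0" for q :: complex
      using that by (auto intro!: derivative_eq_intros simp: field_simps eval_nat_numeral)
    moreover have "((\<lambda>c. 1 - \<i> * c) has_field_derivative - \<i>) (at (l z))"
      by (auto intro!: derivative_eq_intros)
    ultimately have "((\<lambda>c. 1 / (1 - \<i> * c)\<^sup>2) has_field_derivative (- 2 / (1 - \<i> * l z) ^ 3) * - \<i>) (at (l z))"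
      by (intro DERIV_chain2[where f = "\<lambda>q. 1 / q\<^sup>2"]) (use nz(1)[OF z] in auto)
    then have "((\<lambda>c. 1 / (1 - \<i> * c)\<^sup>2) has_field_derivative b z) (at (l z))"
      by (simp add: b_def)
    then have "((\<lambda>c. 1 / (1 - \<i> * c)\<^sup>2) has_derivative (*) (b z)) (at (l z))"
      by (simp add: has_field_derivative_def)
    then show ?thesis
      unfolding f by (rule has_derivative_compose[OF bounded_linear_imp_has_derivative[OF lb]])
  qed
  have bcl: "bounded_clinear (\<lambda>w. c * l w)" for c
    unfolding bounded_clinear_def
    by (auto simp: lc scaleC_complex_def intro: bounded_linear_compose[OF bounded_linear_mult_right lb])
  show hol: "holomorphic_map_on f (ball 0 1)"
    unfolding holomorphic_map_on_def using der bcl by blast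
  show "z \<in> ball 0 1 \<Longrightarrow> blinfun_apply (fderiv f z) w = 2 * \<i> * l w / (1 - \<i> * l z) ^ 3" for z
    by (simp add: fderiv_eqI[OF der] b_def)
  let ?F = "\<lambda>z. f z *\<^sub>C z"
  have derF: "(?F has_derivative (\<lambda>w. f z *\<^sub>C w + (b z * l w) *\<^sub>C z)) (at z)" if "z \<in> ball 0 1" for z
    by (rule has_derivative_scaleC_ident[OF der[OF that]])
  have fz: "f z \<noteq> 0" and sum: "f z + b z * l z = f z * half_plane_map (\<i> * l z)"
    and sum0: "f z + b z * l z \<noteq> 0" if z: "z \<in> ball 0 1" for z
  proof -
    show "f z \<noteq> 0" using nz(1)[OF z] by (simp add: f)
    show "f z + b z * l z = f z * half_plane_map (\<i> * l z)"
    proof -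
      define q where "q = 1 - \<i> * l z"
      have q: "q \<noteq> 0" using nz(1)[OF z] by (simp add: q_def)
      have *: "f z = 1 / q\<^sup>2" "b z * l z = 2 * (1 - q) / q ^ 3" "half_plane_map (\<i> * l z) = (2 - q) / q"
        by (simp_all add: f b_def q_def half_plane_map_def)
      have "1 / q\<^sup>2 + 2 * (1 - q) / q ^ 3 = 1 / q\<^sup>2 * ((2 - q) / q)"
        using q by (simp add: field_simps power2_eq_square power3_eq_cube)
      then show ?thesis unfolding * .
    qed
    then show "f z + b z * l z \<noteq> 0" using nz[OF z] by (simp add: f half_plane_map_def)
  qed
  have bij: "bij (blinfun_apply (fderiv ?F z))" "bounded_linear (inv (blinfun_apply (fderiv ?F z)))"
    if z: "z \<in> ball 0 1" for z
    using rank_one_perturbation_inverse[OF l fz[OF z] sum0[OF z] refl]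
    by (simp_all add: fderiv_eqI[OF derF[OF z]])
  show "?F \<in> starlike_maps"
    unfolding starlike_maps_def mem_Collect_eq
  proof (intro conjI ballI)
    show "holomorphic_map_on ?F (ball 0 1)"
      unfolding holomorphic_map_on_def
    proof
      fix z :: 'a assume z: "z \<in> ball 0 1"
      have "bounded_clinear (\<lambda>w. f z *\<^sub>C w + (b z * l w) *\<^sub>C z)"
        using has_derivative_bounded_linear[OF derF[OF z]]
        by (simp add: bounded_clinear_def lc scaleC_add_right scaleC_scaleC mult_ac)
      then show "\<exists>L. bounded_clinear L \<and> (?F has_derivative L) (at z)" using derF[OF z] by blast
    qed
    have l0: "l 0 = 0" using linear_simps(3)[OF lb] .
    show "normalized_map ?F"
      unfolding normalized_map_def
    proof
      have "blinfun_apply (fderiv ?F 0) = (\<lambda>w. w)"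
        using fderiv_eqI[OF derF[of 0]] by (simp add: f l0 scaleC_one scaleC.zero_right)
      then show "fderiv ?F 0 = id_blinfun" by (auto intro!: blinfun_eqI)
    qed (simp add: scaleC.zero_right)
    show "locally_biholomorphic ?F" using bij by (simp add: locally_biholomorphic_def)
    fix z m assume z: "z \<in> ball 0 1 - {0 :: 'a}" and m: "m \<in> support_functionals z"
    have "complex_of_real (norm z) / m (inv (blinfun_apply (fderiv ?F z)) (?F z)) = (f z + b z * l z) / f z"
      using starlike_quotient[OF hol _ _ m] bij z by (simp add: fderiv_eqI[OF der])
    also have "\<dots> = half_plane_map (\<i> * l z)" using sum[of z] fz[of z] z by simp
    finally show "complex_of_real (norm z) / m (inv (blinfun_apply (fderiv ?F z)) (?F z)) \<in> half_plane_map ` ball 0 1"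
      using il[of z] z by auto
  qed
qed

theorem corollary5p1:
  assumes nontrivial: "\<exists>x::'a::complex_banach. x \<noteq> 0"
  shows "(\<forall>f::'a \<Rightarrow> complex. \<forall>F.
            holomorphic_map_on f (ball 0 1) \<longrightarrow> f 0 = 1 \<longrightarrow>
            F = (\<lambda>z. f z *\<^sub>C z) \<longrightarrow> F \<in> starlike_maps \<longrightarrow>
            (\<forall>z. z \<noteq> 0 \<longrightarrow> (\<forall>l\<in>support_functionals z.
               cmod (A2 F l z ^ 3 - 2 * A2 F l z * A3 F l z ^ 2
                     - A2 F l z * A4 F l z ^ 2 + 2 * A3 F l z ^ 2 * A4 F l z) \<le> 84)))
       \<and> (\<exists>(f::'a \<Rightarrow> complex) F z l.
            holomorphic_map_on f (ball 0 1) \<and> f 0 = 1 \<and>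
            F = (\<lambda>z. f z *\<^sub>C z) \<and> F \<in> starlike_maps \<and>
            z \<noteq> 0 \<and> l \<in> support_functionals z \<and>
            cmod (A2 F l z ^ 3 - 2 * A2 F l z * A3 F l z ^ 2
                  - A2 F l z * A4 F l z ^ 2 + 2 * A3 F l z ^ 2 * A4 F l z) = 84)"
proof (intro conjI allI impI ballI)
  show "cmod (A2 F l z ^ 3 - 2 * A2 F l z * A3 F l z ^ 2
                     - A2 F l z * A4 F l z ^ 2 + 2 * A3 F l z ^ 2 * A4 F l z) \<le> 84"
    if "holomorphic_map_on f (ball 0 1)" "f 0 = 1" "F = (\<lambda>z. f z *\<^sub>C z)" "F \<in> starlike_maps"
      "z \<noteq> 0" "l \<in> support_functionals z" for f F and z :: 'a and l
    by (rule starlike_determinant_bound[OF that])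
next
  obtain z :: 'a where z: "z \<noteq> 0" using nontrivial by blast
  obtain l where l: "l \<in> support_functionals z" using support_functionals_nonempty[OF z] by blast
  have lcl: "bounded_clinear l" and lb: "bounded_linear l" and lz: "l z = of_real (norm z)" and on: "onorm l = 1"
    and lc: "\<And>c x. l (c *\<^sub>C x) = c * l x"
    using l by (auto simp: support_functionals_def bounded_clinear_def scaleC_complex_def)
  have bd: "cmod (l x) \<le> norm x" for x using onorm[OF lb, of x] on by simp
  define f where "f = (\<lambda>z. 1 / (1 - \<i> * l z)\<^sup>2)"
  define F where "F = (\<lambda>z. f z *\<^sub>C z)"
  note ext = extremal_starlike_map[OF lcl bd f_def]
  have f0: "f 0 = 1" using linear_simps(3)[OF lb] by (simp add: f_def)
  define u where "u = (1 / norm z) *\<^sub>R z"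
  have u1: "norm u = 1" using z by (simp add: u_def)
  have lu: "l u = 1" using z by (simp add: u_def linear_simps(5)[OF lb] lz scaleR_conv_of_real)
  define h where "h = (\<lambda>\<zeta>. f (\<zeta> *\<^sub>C u))"
  note slice = slice_of_scaleC_ident[OF ext(1) f0 z l u_def h_def]
  (* along u the extremal map has the constant Schwarz quotient \<i> *)
  have eq: "deriv h \<zeta> = (\<lambda>_. \<i>) \<zeta> * (2 * h \<zeta> + \<zeta> * deriv h \<zeta>)" if \<zeta>: "\<zeta> \<in> ball 0 1" for \<zeta>
  proof -
    have d: "deriv h \<zeta> = 2 * \<i> / (1 - \<i> * \<zeta>) ^ 3"
      using slice(3)[OF \<zeta>] ext(3)[of "\<zeta> *\<^sub>C u" u] \<zeta> u1 lu by (simp add: norm_scaleC lc)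
    have hz: "h \<zeta> = 1 / (1 - \<i> * \<zeta>)\<^sup>2" by (simp add: h_def f_def lc lu)
    define q where "q = 1 - \<i> * \<zeta>"
    have q: "q \<noteq> 0" using \<zeta> by (auto simp: q_def dest: arg_cong[where f = cmod] simp: norm_mult)
    have "2 * h \<zeta> + \<zeta> * deriv h \<zeta> = 2 / q\<^sup>2 + 2 * (1 - q) / q ^ 3"
      unfolding d hz by (simp add: q_def)
    also have "\<dots> = 2 / q ^ 3" using q by (simp add: field_simps power2_eq_square power3_eq_cube)
    finally show ?thesis unfolding d by (simp add: q_def)
  qed
  note co = starlike_coefficients_by_schwarz[OF slice(1,2) holomorphic_on_const eq refl refl refl refl]
  have "A2 F l z = 2 * \<i>" "A3 F l z = - 3" "A4 F l z = - 4 * \<i>"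
    unfolding F_def slice(4-6) by (simp_all only: co) (simp_all add: numeral_2_eq_2 power2_eq_square power3_eq_cube)
  then have "cmod (A2 F l z ^ 3 - 2 * A2 F l z * A3 F l z ^ 2
                  - A2 F l z * A4 F l z ^ 2 + 2 * A3 F l z ^ 2 * A4 F l z) = cmod (- 84 * \<i>)"
    by (simp add: power2_eq_square power3_eq_cube)
  also have "\<dots> = 84" by (simp add: norm_mult)
  finally show "\<exists>(f::'a \<Rightarrow> complex) F z l.
            holomorphic_map_on f (ball 0 1) \<and> f 0 = 1 \<and>
            F = (\<lambda>z. f z *\<^sub>C z) \<and> F \<in> starlike_maps \<and>
            z \<noteq> 0 \<and> l \<in> support_functionals z \<and>
            cmod (A2 F l z ^ 3 - 2 * A2 F l z * A3 F l z ^ 2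
                  - A2 F l z * A4 F l z ^ 2 + 2 * A3 F l z ^ 2 * A4 F l z) = 84"
    using ext(1,2) f0 z l F_def by blast
qed

end
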